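(* Let $(M,\eta)$ be a contact manifold endowed with a bi-Legendrian structure $({\mathcal F}_1,{\mathcal F}_2)$ such that $\nabla^{bl}\Pi_{{\mathcal F}_1}=\nabla^{bl}\Pi_{{\mathcal F}_2}=0$, where $\nabla^{bl}$ is the associated bi-Legendrian connection. Assume that one of the following conditions holds: (I) ${\mathcal F}_1$ and ${\mathcal F}_2$ are positive definite and there exist two positive numbers $a$ and $b$ such that $\overline\Pi_{{\mathcal F}_1}=ab\,\overline\Pi_{{\mathcal F}_2}$ on $T{\mathcal F}_1$ and $\overline\Pi_{{\mathcal F}_2}=ab\,\overline\Pi_{{\mathcal F}_1}$ on $T{\mathcal F}_2$; (II) ${\mathcal F}_1$ is positive definite, ${\mathcal F}_2$ is negative definite and there exist $a>0$ and $b<0$ such that $\overline\Pi_{{\mathcal F}_1}=ab\,\overline\Pi_{{\mathcal F}_2}$ on $T{\mathcal F}_1$ and $\overline\Pi_{{\mathcal F}_2}=ab\,\overline\Pi_{{\mathcal F}_1}$ on $T{\mathcal F}_2$; (III) ${\mathcal F}_1$ and ${\mathcal F}_2$ are negative definite and there exist two negative numbers $a$ and $b$ such that $\overline\Pi_{{\mathcal F}_1}=ab\,\overline\Pi_{{\mathcal F}_2}$ on $T{\mathcal F}_1$ and $\overline\Pi_{{\mathcal F}_2}=ab\,\overline\Pi_{{\mathcal F}_1}$ on $T{\mathcal F}_2$. Then $(M,\eta)$ admits a compatible contact metric structure $(\varphi,\xi,\eta,g)$ such that (i) if $a=b$, $(M,\varphi,\xi,\eta,g)$ is a Sasakian manifold;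 (ii) if $a\neq b$, $(M,\varphi,\xi,\eta,g)$ is a contact metric $(\kappa,\mu)$-manifold, whose associated bi-Legendrian structure is (as an unordered pair) $({\mathcal F}_1,{\mathcal F}_2)$, where $$\kappa=1-\frac{(a-b)^2}{16},\qquad \mu=2-\frac{a+b}{2}.$$
   Context: Convention: $2d\eta(X,Y)=X(\eta(Y))-Y(\eta(X))-\eta([X,Y])$. A contact manifold is a $(2n+1)$-dimensional smooth manifold $M$ with a 1-form $\eta$ such that $\eta\wedge(d\eta)^n\neq0$ everywhere; its Reeb vector field $\xi$ is determined by $\eta(\xi)=1$, $i_\xi d\eta=0$. A contact metric structure $(\varphi,\xi,\eta,g)$ compatible with $\eta$ consists of $\eta$, its Reeb field $\xi$, a $(1,1)$-tensor field $\varphi$ and a Riemannian metric $g$ with $\varphi^2=-I+\eta\otimes\xi$, $d\eta(X,Y)=g(X,\varphi Y)$, $g(\varphi X,\varphi Y)=g(X,Y)-\eta(X)\eta(Y)$. Put $h=\frac12{\mathcal L}_\xi\varphi$. It is Sasakian if $R_{XY}\xi=\eta(Y)X-\eta(X)Y$ ($R$ the Levi-Civita curvature of $g$), equivalently if $N_\varphi(X,Y)=\varphi^2[X,Y]+[\varphi X,\varphi Y]-\varphi[\varphi X,Y]-\varphi[X,\varphi Y]+2d\eta(X,Y)\xi$ vanishes. It is a contact metric $(\kappa,\mu)$-manifold ($\kappa,\mu\in\mathbb{R}$) if $R_{XY}\xi=\kappa(\eta(Y)X-\eta(X)Y)+\mu(\eta(Y)hX-\eta(X)hY)$ for all $X,Y$.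 If $\kappa<1$, then $TM$ is the orthogonal sum of $\mathbb{R}\xi$ and the eigendistributions ${\mathcal D}(\lambda)$, ${\mathcal D}(-\lambda)$ of $h$, $\lambda=\sqrt{1-\kappa}$, which define two Legendre foliations; this pair is the associated bi-Legendrian structure. A Legendre foliation ${\mathcal F}$ of $(M^{2n+1},\eta)$ is a foliation whose tangent bundle $T{\mathcal F}$ is an $n$-dimensional subbundle of $\ker\eta$ (on which $d\eta$ then vanishes). Its Pang invariant is the symmetric bilinear form on $T{\mathcal F}$, $\Pi_{\mathcal F}(X,X')=-({\mathcal L}_X{\mathcal L}_{X'}\eta)(\xi)=2d\eta([\xi,X],X')$. ${\mathcal F}$ is non-degenerate, positive definite, negative definite if $\Pi_{\mathcal F}$ is. For ${\mathcal F}$ non-degenerate, the Libermann map $\Lambda_{\mathcal F}:TM\to T{\mathcal F}$ is defined by $\Pi_{\mathcal F}(\Lambda_{\mathcal F}Z,X)=d\eta(Z,X)$ for $Z\in\Gamma(TM)$, $X\in\Gamma(T{\mathcal F})$; and $\overline\Pi_{\mathcal F}(Z,Z')=\Pi_{\mathcal F}(Z,Z')$ if $Z,Z'\in\Gamma(T{\mathcal F})$, $\overline\Pi_{\mathcal F}(Z,Z')=\Pi_{\mathcal F}(\Lambda_{\mathcal F}Z,\Lambda_{\mathcal F}Z')$ otherwise. A bi-Legendrian structure on $(M,\eta)$ is a pair $({\mathcal F}_1,{\mathcal F}_2)$ of transversal Legendre foliations, so that $TM=L_1\oplus L_2\oplus\mathbb{R}\xi$ with $L_i=T{\mathcal F}_i$.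 Its bi-Legendrian connection $\nabla^{bl}$ is the unique linear connection such that: (i) $\nabla^{bl}L_1\subset L_1$, $\nabla^{bl}L_2\subset L_2$; (ii) $\nabla^{bl}\xi=0$, $\nabla^{bl}d\eta=0$; (iii) its torsion satisfies $T^{bl}(X,Y)=2d\eta(X,Y)\xi$ for $X\in\Gamma(L_1)$, $Y\in\Gamma(L_2)$, and $T^{bl}(X,\xi)=[\xi,X_{L_1}]_{L_2}+[\xi,X_{L_2}]_{L_1}$ for all $X\in\Gamma(TM)$, where subscripts denote projections onto $L_1,L_2$ in the splitting $TM=L_1\oplus L_2\oplus\mathbb{R}\xi$. *)

theory Defs
  imports "HOL-Analysis.Analysis" "HOL-Combinatorics.Permutations" "HOL-Library.Function_Algebras"
begin

text \<open>
  Smooth manifolds are Hausdorff second countable spaces \<open>'m\<close> with a smooth atlas \<open>A\<close> modelled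
  on a Euclidean space \<open>'e\<close>. Vector fields are derivations of the algebra of smooth functions, and
  tensor fields are multilinear maps over that algebra on vector fields. All structures are thus
  maps on vector fields and smooth functions, added pointwise by \<^theory>\<open>HOL-Library.Function_Algebras\<close>.
\<close>

section \<open>Smooth manifolds\<close>

primrec Ck_on :: "nat \<Rightarrow> 'a::real_normed_vector set \<Rightarrow> ('a \<Rightarrow> 'b::real_normed_vector) \<Rightarrow> bool" where
  "Ck_on 0 S f \<longleftrightarrow> continuous_on S f"
| "Ck_on (Suc k) S f \<longleftrightarrow>
     (\<forall>x\<in>S. f differentiable (at x)) \<and> (\<forall>v. Ck_on k S (\<lambda>x. frechet_derivative f (at x) v))"

text \<open>Only used for open \<open>S\<close>.\<close>

definition smooth_on :: "'a::real_normed_vector set \<Rightarrow> ('a \<Rightarrow> 'b::real_normed_vector) \<Rightarrow> bool" where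
  "smooth_on S f \<longleftrightarrow> (\<forall>k. Ck_on k S f)"

type_synonym ('m, 'e) atlas = "('m set \<times> ('m \<Rightarrow> 'e)) set"

definition smooth_atlas ::
  "('m::{t2_space, second_countable_topology}, 'e::euclidean_space) atlas \<Rightarrow> bool" where
  "smooth_atlas A \<longleftrightarrow>
     (\<Union>(U, x)\<in>A. U) = UNIV \<and>
     (\<forall>(U, x)\<in>A. open U \<and> open (x ` U) \<and> homeomorphism U (x ` U) x (inv_into U x)) \<and>
     (\<forall>(U, x)\<in>A. \<forall>(V, y)\<in>A. smooth_on (x ` (U \<inter> V)) (y \<circ> inv_into U x))"

definition smooth_fun :: "('m, 'e::euclidean_space) atlas \<Rightarrow> ('m \<Rightarrow> real) set" where
  "smooth_fun A = {f. \<forall>(U, x)\<in>A. smooth_on (x ` U) (f \<circ> inv_into U x)}"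

section \<open>Vector fields and tensor fields\<close>

type_synonym 'm vfield = "('m \<Rightarrow> real) \<Rightarrow> 'm \<Rightarrow> real"

definition fscale :: "('m \<Rightarrow> real) \<Rightarrow> 'm vfield \<Rightarrow> 'm vfield"  (infixr \<open>\<star>\<close> 75) where
  "f \<star> X = (\<lambda>u. f * X u)"

text \<open>The last condition makes a vector field determined, as a HOL function, by its action on
  smooth functions.\<close>

definition vector_fields :: "('m, 'e::euclidean_space) atlas \<Rightarrow> 'm vfield set" where
  "vector_fields A = {X.
     (\<forall>f\<in>smooth_fun A. X f \<in> smooth_fun A) \<and>
     (\<forall>f\<in>smooth_fun A. \<forall>g\<in>smooth_fun A. X (f + g) = X f + X g) \<and>
     (\<forall>f\<in>smooth_fun A. \<forall>c. X (\<lambda>p. c * f p) = (\<lambda>p. c * X f p)) \<and>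
     (\<forall>f\<in>smooth_fun A. \<forall>g\<in>smooth_fun A. X (f * g) = f * X g + g * X f) \<and>
     (\<forall>f. f \<notin> smooth_fun A \<longrightarrow> X f = 0)}"

text \<open>The value of a vector field at \<open>p\<close>, as a derivation at \<open>p\<close>.\<close>

definition value_at :: "'m vfield \<Rightarrow> 'm \<Rightarrow> ('m \<Rightarrow> real) \<Rightarrow> real" where
  "value_at X p = (\<lambda>f. X f p)"

definition lie_bracket :: "'m vfield \<Rightarrow> 'm vfield \<Rightarrow> 'm vfield" where
  "lie_bracket X Y = (\<lambda>f. X (Y f) - Y (X f))"

definition one_form :: "('m, 'e::euclidean_space) atlas \<Rightarrow> ('m vfield \<Rightarrow> 'm \<Rightarrow> real) \<Rightarrow> bool" where
  "one_form A \<omega> \<longleftrightarrow>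
     (\<forall>X\<in>vector_fields A. \<omega> X \<in> smooth_fun A) \<and>
     (\<forall>X\<in>vector_fields A. \<forall>Y\<in>vector_fields A. \<omega> (X + Y) = \<omega> X + \<omega> Y) \<and>
     (\<forall>X\<in>vector_fields A. \<forall>f\<in>smooth_fun A. \<omega> (f \<star> X) = f * \<omega> X)"

definition tensor11 :: "('m, 'e::euclidean_space) atlas \<Rightarrow> ('m vfield \<Rightarrow> 'm vfield) \<Rightarrow> bool" where
  "tensor11 A \<phi> \<longleftrightarrow>
     (\<forall>X\<in>vector_fields A. \<phi> X \<in> vector_fields A) \<and>
     (\<forall>X\<in>vector_fields A. \<forall>Y\<in>vector_fields A. \<phi> (X + Y) = \<phi> X + \<phi> Y) \<and>
     (\<forall>X\<in>vector_fields A. \<forall>f\<in>smooth_fun A. \<phi> (f \<star> X) = f \<star> \<phi> X)"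

definition riemannian_metric ::
  "('m, 'e::euclidean_space) atlas \<Rightarrow> ('m vfield \<Rightarrow> 'm vfield \<Rightarrow> 'm \<Rightarrow> real) \<Rightarrow> bool" where
  "riemannian_metric A g \<longleftrightarrow>
     (\<forall>X\<in>vector_fields A. one_form A (g X)) \<and>
     (\<forall>X\<in>vector_fields A. \<forall>Y\<in>vector_fields A. g X Y = g Y X) \<and>
     (\<forall>X\<in>vector_fields A. \<forall>p. value_at X p \<noteq> 0 \<longrightarrow> g X X p > 0)"

section \<open>Linear connections\<close>

definition linear_connection ::
  "('m, 'e::euclidean_space) atlas \<Rightarrow> ('m vfield \<Rightarrow> 'm vfield \<Rightarrow> 'm vfield) \<Rightarrow> bool" where
  "linear_connection A D \<longleftrightarrow>
     (\<forall>Y\<in>vector_fields A. tensor11 A (\<lambda>X. D X Y)) \<and>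
     (\<forall>X\<in>vector_fields A. \<forall>Y\<in>vector_fields A. \<forall>Z\<in>vector_fields A. D X (Y + Z) = D X Y + D X Z) \<and>
     (\<forall>X\<in>vector_fields A. \<forall>Y\<in>vector_fields A. \<forall>f\<in>smooth_fun A.
        D X (f \<star> Y) = f \<star> D X Y + X f \<star> Y)"

definition torsion :: "('m vfield \<Rightarrow> 'm vfield \<Rightarrow> 'm vfield) \<Rightarrow> 'm vfield \<Rightarrow> 'm vfield \<Rightarrow> 'm vfield" where
  "torsion D X Y = D X Y - D Y X - lie_bracket X Y"

definition curvature ::
  "('m vfield \<Rightarrow> 'm vfield \<Rightarrow> 'm vfield) \<Rightarrow> 'm vfield \<Rightarrow> 'm vfield \<Rightarrow> 'm vfield \<Rightarrow> 'm vfield" where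
  "curvature D X Y Z = D X (D Y Z) - D Y (D X Z) - D (lie_bracket X Y) Z"

text \<open>The covariant derivative of a bilinear form.\<close>

definition cov_deriv2 ::
  "('m vfield \<Rightarrow> 'm vfield \<Rightarrow> 'm vfield) \<Rightarrow> ('m vfield \<Rightarrow> 'm vfield \<Rightarrow> 'm \<Rightarrow> real) \<Rightarrow>
   'm vfield \<Rightarrow> 'm vfield \<Rightarrow> 'm vfield \<Rightarrow> 'm \<Rightarrow> real" where
  "cov_deriv2 D B Z X Y = Z (B X Y) - B (D Z X) Y - B X (D Z Y)"

definition levi_civita ::
  "('m, 'e::euclidean_space) atlas \<Rightarrow> ('m vfield \<Rightarrow> 'm vfield \<Rightarrow> 'm \<Rightarrow> real) \<Rightarrow>
   ('m vfield \<Rightarrow> 'm vfield \<Rightarrow> 'm vfield) \<Rightarrow> bool" where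
  "levi_civita A g D \<longleftrightarrow>
     linear_connection A D \<and>
     (\<forall>X\<in>vector_fields A. \<forall>Y\<in>vector_fields A. torsion D X Y = 0) \<and>
     (\<forall>X\<in>vector_fields A. \<forall>Y\<in>vector_fields A. \<forall>Z\<in>vector_fields A. cov_deriv2 D g Z X Y = 0)"

section \<open>Contact structures\<close>

text \<open>The convention is \<open>2 d\<eta>(X,Y) = X(\<eta>(Y)) - Y(\<eta>(X)) - \<eta>([X,Y])\<close>.\<close>

definition ext_d :: "('m vfield \<Rightarrow> 'm \<Rightarrow> real) \<Rightarrow> 'm vfield \<Rightarrow> 'm vfield \<Rightarrow> 'm \<Rightarrow> real" where
  "ext_d \<eta> X Y = (\<lambda>p. (X (\<eta> Y) p - Y (\<eta> X) p - \<eta> (lie_bracket X Y) p) / 2)"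

text \<open>\<open>(\<eta> \<and> (d\<eta>)\<^sup>n)(X\<^sub>0, \<dots>, X\<^sub>2\<^sub>n)\<close>, up to the positive constant of the chosen wedge product convention.\<close>

definition contact_volume ::
  "nat \<Rightarrow> ('m vfield \<Rightarrow> 'm \<Rightarrow> real) \<Rightarrow> (nat \<Rightarrow> 'm vfield) \<Rightarrow> 'm \<Rightarrow> real" where
  "contact_volume n \<eta> X p =
     (\<Sum>\<sigma> | \<sigma> permutes {..2 * n}. of_int (sign \<sigma>) * \<eta> (X (\<sigma> 0)) p *
        (\<Prod>i<n. ext_d \<eta> (X (\<sigma> (2 * i + 1))) (X (\<sigma> (2 * i + 2))) p))"

definition contact_manifold ::
  "nat \<Rightarrow> ('m::{t2_space, second_countable_topology}, 'e::euclidean_space) atlas \<Rightarrow>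
   ('m vfield \<Rightarrow> 'm \<Rightarrow> real) \<Rightarrow> bool" where
  "contact_manifold n A \<eta> \<longleftrightarrow>
     smooth_atlas A \<and> DIM('e) = 2 * n + 1 \<and> one_form A \<eta> \<and>
     (\<forall>p. \<exists>X. (\<forall>i\<le>2 * n. X i \<in> vector_fields A) \<and> contact_volume n \<eta> X p \<noteq> 0)"

definition reeb_field ::
  "('m, 'e::euclidean_space) atlas \<Rightarrow> ('m vfield \<Rightarrow> 'm \<Rightarrow> real) \<Rightarrow> 'm vfield \<Rightarrow> bool" where
  "reeb_field A \<eta> \<xi> \<longleftrightarrow>
     \<xi> \<in> vector_fields A \<and> \<eta> \<xi> = 1 \<and> (\<forall>X\<in>vector_fields A. ext_d \<eta> \<xi> X = 0)"

definition contact_metric_structure ::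
  "('m, 'e::euclidean_space) atlas \<Rightarrow> ('m vfield \<Rightarrow> 'm vfield) \<Rightarrow> 'm vfield \<Rightarrow>
   ('m vfield \<Rightarrow> 'm \<Rightarrow> real) \<Rightarrow> ('m vfield \<Rightarrow> 'm vfield \<Rightarrow> 'm \<Rightarrow> real) \<Rightarrow> bool" where
  "contact_metric_structure A \<phi> \<xi> \<eta> g \<longleftrightarrow>
     one_form A \<eta> \<and> reeb_field A \<eta> \<xi> \<and> tensor11 A \<phi> \<and> riemannian_metric A g \<and>
     (\<forall>X\<in>vector_fields A. \<phi> (\<phi> X) = - X + \<eta> X \<star> \<xi>) \<and>
     (\<forall>X\<in>vector_fields A. \<forall>Y\<in>vector_fields A. ext_d \<eta> X Y = g X (\<phi> Y)) \<and>
     (\<forall>X\<in>vector_fields A. \<forall>Y\<in>vector_fields A. g (\<phi> X) (\<phi> Y) = g X Y - \<eta> X * \<eta> Y)"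

text \<open>\<open>h\<close> is half the Lie derivative of \<open>\<phi>\<close> along \<open>\<xi>\<close>.\<close>

definition h_tensor :: "('m vfield \<Rightarrow> 'm vfield) \<Rightarrow> 'm vfield \<Rightarrow> 'm vfield \<Rightarrow> 'm vfield" where
  "h_tensor \<phi> \<xi> X = (\<lambda>_. 1/2) \<star> (lie_bracket \<xi> (\<phi> X) - \<phi> (lie_bracket \<xi> X))"

text \<open>The connection \<open>D\<close> below is unique: it is the Levi-Civita connection of \<open>g\<close>.\<close>

definition sasakian ::
  "('m, 'e::euclidean_space) atlas \<Rightarrow> ('m vfield \<Rightarrow> 'm vfield) \<Rightarrow> 'm vfield \<Rightarrow>
   ('m vfield \<Rightarrow> 'm \<Rightarrow> real) \<Rightarrow> ('m vfield \<Rightarrow> 'm vfield \<Rightarrow> 'm \<Rightarrow> real) \<Rightarrow> bool" where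
  "sasakian A \<phi> \<xi> \<eta> g \<longleftrightarrow>
     contact_metric_structure A \<phi> \<xi> \<eta> g \<and>
     (\<exists>D. levi_civita A g D \<and>
        (\<forall>X\<in>vector_fields A. \<forall>Y\<in>vector_fields A.
           curvature D X Y \<xi> = \<eta> Y \<star> X - \<eta> X \<star> Y))"

definition kappa_mu_manifold ::
  "real \<Rightarrow> real \<Rightarrow> ('m, 'e::euclidean_space) atlas \<Rightarrow> ('m vfield \<Rightarrow> 'm vfield) \<Rightarrow> 'm vfield \<Rightarrow>
   ('m vfield \<Rightarrow> 'm \<Rightarrow> real) \<Rightarrow> ('m vfield \<Rightarrow> 'm vfield \<Rightarrow> 'm \<Rightarrow> real) \<Rightarrow> bool" where
  "kappa_mu_manifold \<kappa> \<mu> A \<phi> \<xi> \<eta> g \<longleftrightarrow>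
     contact_metric_structure A \<phi> \<xi> \<eta> g \<and>
     (\<exists>D. levi_civita A g D \<and>
        (\<forall>X\<in>vector_fields A. \<forall>Y\<in>vector_fields A.
           curvature D X Y \<xi> =
             (\<lambda>_. \<kappa>) \<star> (\<eta> Y \<star> X - \<eta> X \<star> Y) +
             (\<lambda>_. \<mu>) \<star> (\<eta> Y \<star> h_tensor \<phi> \<xi> X - \<eta> X \<star> h_tensor \<phi> \<xi> Y)))"

section \<open>Distributions and Legendre foliations\<close>

text \<open>A distribution assigns to each point a set of tangent vectors.\<close>

type_synonym 'm distribution = "'m \<Rightarrow> (('m \<Rightarrow> real) \<Rightarrow> real) set"

definition sections :: "('m, 'e::euclidean_space) atlas \<Rightarrow> 'm distribution \<Rightarrow> 'm vfield set" where
  "sections A L = {X \<in> vector_fields A. \<forall>p. value_at X p \<in> L p}"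

text \<open>Smooth local frames; multiplying a frame by a bump function makes it global, so that the
  frame fields can be taken to be global sections.\<close>

definition subbundle ::
  "nat \<Rightarrow> ('m::topological_space, 'e::euclidean_space) atlas \<Rightarrow> 'm distribution \<Rightarrow> bool" where
  "subbundle n A L \<longleftrightarrow>
     (\<forall>p. \<exists>U E. open U \<and> p \<in> U \<and> (\<forall>i<n. E i \<in> sections A L) \<and>
        (\<forall>q\<in>U. L q = {\<lambda>f. \<Sum>i<n. c i * value_at (E i) q f |c. True} \<and>
               (\<forall>c. (\<forall>f. (\<Sum>i<n. c i * value_at (E i) q f) = 0) \<longrightarrow> (\<forall>i<n. c i = 0))))"

text \<open>A foliation is given by its tangent bundle, an involutive subbundle (Frobenius).\<close>

definition legendre_foliation ::
  "nat \<Rightarrow> ('m::topological_space, 'e::euclidean_space) atlas \<Rightarrow> ('m vfield \<Rightarrow> 'm \<Rightarrow> real) \<Rightarrow>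
   'm distribution \<Rightarrow> bool" where
  "legendre_foliation n A \<eta> L \<longleftrightarrow>
     subbundle n A L \<and>
     (\<forall>X\<in>sections A L. \<eta> X = 0) \<and>
     (\<forall>X\<in>sections A L. \<forall>Y\<in>sections A L. lie_bracket X Y \<in> sections A L)"

text \<open>The Pang invariant \<open>-(Lie_X (Lie_X' \<eta>))(\<xi>) = 2 d\<eta>([\<xi>,X],X')\<close>, for sections \<open>X\<close>, \<open>X'\<close> of a Legendre foliation.\<close>

definition pang ::
  "('m vfield \<Rightarrow> 'm \<Rightarrow> real) \<Rightarrow> 'm vfield \<Rightarrow> 'm vfield \<Rightarrow> 'm vfield \<Rightarrow> 'm \<Rightarrow> real" where
  "pang \<eta> \<xi> X X' = (\<lambda>p. 2 * ext_d \<eta> (lie_bracket \<xi> X) X' p)"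

definition pang_pos_def ::
  "('m, 'e::euclidean_space) atlas \<Rightarrow> ('m vfield \<Rightarrow> 'm \<Rightarrow> real) \<Rightarrow> 'm vfield \<Rightarrow> 'm distribution \<Rightarrow> bool"
  where
  "pang_pos_def A \<eta> \<xi> L \<longleftrightarrow>
     (\<forall>X\<in>sections A L. \<forall>p. value_at X p \<noteq> 0 \<longrightarrow> pang \<eta> \<xi> X X p > 0)"

definition pang_neg_def ::
  "('m, 'e::euclidean_space) atlas \<Rightarrow> ('m vfield \<Rightarrow> 'm \<Rightarrow> real) \<Rightarrow> 'm vfield \<Rightarrow> 'm distribution \<Rightarrow> bool"
  where
  "pang_neg_def A \<eta> \<xi> L \<longleftrightarrow>
     (\<forall>X\<in>sections A L. \<forall>p. value_at X p \<noteq> 0 \<longrightarrow> pang \<eta> \<xi> X X p < 0)"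

text \<open>For non-degenerate \<open>L\<close> the Libermann map is determined by this property.\<close>

definition libermann_map ::
  "('m, 'e::euclidean_space) atlas \<Rightarrow> ('m vfield \<Rightarrow> 'm \<Rightarrow> real) \<Rightarrow> 'm vfield \<Rightarrow> 'm distribution \<Rightarrow>
   ('m vfield \<Rightarrow> 'm vfield) \<Rightarrow> bool" where
  "libermann_map A \<eta> \<xi> L \<Lambda> \<longleftrightarrow>
     (\<forall>Z\<in>vector_fields A. \<Lambda> Z \<in> sections A L \<and>
        (\<forall>X\<in>sections A L. pang \<eta> \<xi> (\<Lambda> Z) X = ext_d \<eta> Z X))"

definition pang_bar ::
  "('m, 'e::euclidean_space) atlas \<Rightarrow> ('m vfield \<Rightarrow> 'm \<Rightarrow> real) \<Rightarrow> 'm vfield \<Rightarrow> 'm distribution \<Rightarrow>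
   ('m vfield \<Rightarrow> 'm vfield) \<Rightarrow> 'm vfield \<Rightarrow> 'm vfield \<Rightarrow> 'm \<Rightarrow> real" where
  "pang_bar A \<eta> \<xi> L \<Lambda> Z Z' =
     (if Z \<in> sections A L \<and> Z' \<in> sections A L then pang \<eta> \<xi> Z Z'
      else pang \<eta> \<xi> (\<Lambda> Z) (\<Lambda> Z'))"

section \<open>Bi-Legendrian structures\<close>

text \<open>The splitting \<open>TM = L1 \<oplus> L2 \<oplus> \<real>\<xi>\<close>: the sum is direct in each tangent space, and every vector
  field is a sum of smooth sections of the three subbundles. Transversality of \<open>L1\<close> and \<open>L2\<close> is
  the directness; the rest holds because the ranks \<open>n\<close>, \<open>n\<close>, \<open>1\<close> add up to the dimension.\<close>

definition bi_legendrian ::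
  "nat \<Rightarrow> ('m::topological_space, 'e::euclidean_space) atlas \<Rightarrow> ('m vfield \<Rightarrow> 'm \<Rightarrow> real) \<Rightarrow>
   'm vfield \<Rightarrow> 'm distribution \<Rightarrow> 'm distribution \<Rightarrow> bool" where
  "bi_legendrian n A \<eta> \<xi> L1 L2 \<longleftrightarrow>
     legendre_foliation n A \<eta> L1 \<and> legendre_foliation n A \<eta> L2 \<and>
     (\<forall>p. \<forall>u\<in>L1 p. \<forall>v\<in>L2 p. \<forall>c.
        u + v + (\<lambda>f. c * value_at \<xi> p f) = 0 \<longrightarrow> u = 0 \<and> v = 0 \<and> c = 0) \<and>
     (\<forall>X\<in>vector_fields A. \<exists>Y\<in>sections A L1. \<exists>Z\<in>sections A L2. \<exists>f\<in>smooth_fun A.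
        X = Y + Z + f \<star> \<xi>)"

text \<open>Projection onto \<open>L\<close> along \<open>L' \<oplus> \<real>\<xi>\<close>.\<close>

definition proj ::
  "('m, 'e::euclidean_space) atlas \<Rightarrow> 'm vfield \<Rightarrow> 'm distribution \<Rightarrow> 'm distribution \<Rightarrow>
   'm vfield \<Rightarrow> 'm vfield" where
  "proj A \<xi> L L' X =
     (THE Y. Y \<in> sections A L \<and> (\<exists>Z\<in>sections A L'. \<exists>f\<in>smooth_fun A. X = Y + Z + f \<star> \<xi>))"

definition bi_legendrian_connection ::
  "('m, 'e::euclidean_space) atlas \<Rightarrow> ('m vfield \<Rightarrow> 'm \<Rightarrow> real) \<Rightarrow> 'm vfield \<Rightarrow>
   'm distribution \<Rightarrow> 'm distribution \<Rightarrow> ('m vfield \<Rightarrow> 'm vfield \<Rightarrow> 'm vfield) \<Rightarrow> bool" where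
  "bi_legendrian_connection A \<eta> \<xi> L1 L2 D \<longleftrightarrow>
     linear_connection A D \<and>
     (\<forall>X\<in>vector_fields A. \<forall>Y\<in>sections A L1. D X Y \<in> sections A L1) \<and>
     (\<forall>X\<in>vector_fields A. \<forall>Y\<in>sections A L2. D X Y \<in> sections A L2) \<and>
     (\<forall>X\<in>vector_fields A. D X \<xi> = 0) \<and>
     (\<forall>X\<in>vector_fields A. \<forall>Y\<in>vector_fields A. \<forall>Z\<in>vector_fields A.
        cov_deriv2 D (ext_d \<eta>) Z X Y = 0) \<and>
     (\<forall>X\<in>sections A L1. \<forall>Y\<in>sections A L2. torsion D X Y = (\<lambda>p. 2 * ext_d \<eta> X Y p) \<star> \<xi>) \<and>
     (\<forall>X\<in>vector_fields A.
        torsion D X \<xi> = proj A \<xi> L2 L1 (lie_bracket \<xi> (proj A \<xi> L1 L2 X))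
                       + proj A \<xi> L1 L2 (lie_bracket \<xi> (proj A \<xi> L2 L1 X)))"

definition pang_parallel ::
  "('m, 'e::euclidean_space) atlas \<Rightarrow> ('m vfield \<Rightarrow> 'm \<Rightarrow> real) \<Rightarrow> 'm vfield \<Rightarrow>
   ('m vfield \<Rightarrow> 'm vfield \<Rightarrow> 'm vfield) \<Rightarrow> 'm distribution \<Rightarrow> bool" where
  "pang_parallel A \<eta> \<xi> D L \<longleftrightarrow>
     (\<forall>Z\<in>vector_fields A. \<forall>X\<in>sections A L. \<forall>X'\<in>sections A L.
        cov_deriv2 D (pang \<eta> \<xi>) Z X X' = 0)"

definition pang_bar_proportional ::
  "('m, 'e::euclidean_space) atlas \<Rightarrow> ('m vfield \<Rightarrow> 'm \<Rightarrow> real) \<Rightarrow> 'm vfield \<Rightarrow>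
   'm distribution \<Rightarrow> 'm distribution \<Rightarrow> ('m vfield \<Rightarrow> 'm vfield) \<Rightarrow> ('m vfield \<Rightarrow> 'm vfield) \<Rightarrow>
   real \<Rightarrow> bool" where
  "pang_bar_proportional A \<eta> \<xi> L1 L2 \<Lambda>1 \<Lambda>2 c \<longleftrightarrow>
     (\<forall>X\<in>sections A L1. \<forall>Y\<in>sections A L1.
        pang_bar A \<eta> \<xi> L1 \<Lambda>1 X Y = (\<lambda>p. c * pang_bar A \<eta> \<xi> L2 \<Lambda>2 X Y p)) \<and>
     (\<forall>X\<in>sections A L2. \<forall>Y\<in>sections A L2.
        pang_bar A \<eta> \<xi> L2 \<Lambda>2 X Y = (\<lambda>p. c * pang_bar A \<eta> \<xi> L1 \<Lambda>1 X Y p))"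

definition eigendistribution ::
  "('m, 'e::euclidean_space) atlas \<Rightarrow> ('m vfield \<Rightarrow> 'm vfield) \<Rightarrow> real \<Rightarrow> 'm distribution" where
  "eigendistribution A h c =
     (\<lambda>p. {value_at X p |X. X \<in> vector_fields A \<and> value_at (h X) p = (\<lambda>f. c * value_at X p f)})"

text \<open>The pair of foliations associated with a \<open>(\<kappa>,\<mu>)\<close>-structure, \<open>\<kappa> < 1\<close>, is unordered.\<close>

definition associated_bi_legendrian ::
  "real \<Rightarrow> ('m, 'e::euclidean_space) atlas \<Rightarrow> ('m vfield \<Rightarrow> 'm vfield) \<Rightarrow> 'm vfield \<Rightarrow>
   'm distribution \<Rightarrow> 'm distribution \<Rightarrow> bool" where
  "associated_bi_legendrian \<kappa> A \<phi> \<xi> L1 L2 \<longleftrightarrow>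
     \<kappa> < 1 \<and>
     {eigendistribution A (h_tensor \<phi> \<xi>) (sqrt (1 - \<kappa>)),
      eigendistribution A (h_tensor \<phi> \<xi>) (- sqrt (1 - \<kappa>))} = {L1, L2}"

end

theory Submission
  imports Defs
begin

text \<open>
  With \<open>\<Lambda>\<^sub>i\<close> the Libermann maps and \<open>P\<^sub>i\<close> the projections of the splitting, put
  \<open>\<phi> = - (a \<Lambda>\<^sub>1 + b \<Lambda>\<^sub>2)\<close>, \<open>g(X,Y) = \<eta>(X) \<eta>(Y) - d\<eta>(X,\<phi>Y)\<close> and \<open>h = (a - b)/4 (P\<^sub>1 - P\<^sub>2)\<close>. The
  proportionality of the Pang invariants says \<open>a b \<Lambda>\<^sub>1 \<Lambda>\<^sub>2 = - I\<close> on \<open>L\<^sub>1\<close>, hence \<open>\<phi>\<^sup>2 = - I + \<eta> \<otimes> \<xi>\<close>; on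
  \<open>L\<^sub>1\<close> the metric is \<open>\<Pi>\<^sub>1/a\<close>, on \<open>L\<^sub>2\<close> it is \<open>\<Pi>\<^sub>2/b\<close>. All of \<open>\<phi>\<close>, \<open>g\<close>, \<open>h\<close> are parallel for the
  bi-Legendrian connection \<open>D\<close>, whose torsion is \<open>2 d\<eta>(X,Y) \<xi> + \<eta>(Y) S X - \<eta>(X) S Y\<close> with
  \<open>S = k \<phi> + \<phi> h\<close> and \<open>k = (a + b)/4\<close>; the torsion vanishes within each foliation because
  \<open>d(d\<eta>) = 0\<close>. Therefore the Levi-Civita connection is the explicit correction
  \<open>\<nabla>\<^sub>X Y = D\<^sub>X Y + g(Y,N X) \<xi> - \<eta>(Y) N X + (k - 1) \<eta>(X) \<phi> Y\<close> with \<open>N = \<phi> + \<phi> h\<close>, and since \<open>N\<close> is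
  \<open>D\<close>-parallel the curvature \<open>R\<^sub>X\<^sub>Y \<xi>\<close> is an algebraic expression in \<open>\<phi>\<close> and \<open>h\<close>.
\<close>

section \<open>Smooth functions and vector fields\<close>

text \<open>Since \<open>S\<close> is open, the derivative at a point of \<open>S\<close> depends
  only on values on \<open>S\<close>, so the induction passes from functions to their
  derivatives.\<close>

lemma Ck_on_cong:
  assumes "open S" "Ck_on k S f" "\<And>x. x \<in> S \<Longrightarrow> f x = g x"
  shows "Ck_on k S g"
  using assms(2,3)
proof (induction k arbitrary: f g)
  case 0
  then show ?case by (metis Ck_on.simps(1) continuous_on_cong)
next
  case (Suc k)
  have D: "(g has_derivative frechet_derivative f (at x)) (at x)" if "x \<in> S" for x
  proof -
    have "(f has_derivative frechet_derivative f (at x)) (at x)"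
      using Suc.prems(1) that frechet_derivative_works by auto
    then show ?thesis
      by (rule has_derivative_transform_within_open[OF _ \<open>open S\<close> that Suc.prems(2)])
  qed
  have "Ck_on k S (\<lambda>x. frechet_derivative g (at x) v)" for v
  proof (rule Suc.IH)
    show "Ck_on k S (\<lambda>x. frechet_derivative f (at x) v)"
      using Suc.prems(1) by simp
    show "frechet_derivative f (at x) v = frechet_derivative g (at x) v" if "x \<in> S" for x
      using frechet_derivative_at[OF D[OF that]] by simp
  qed
  then show ?case
    using D by (auto simp: differentiable_def)
qed

lemma Ck_on_Suc_imp: "Ck_on (Suc k) S f \<Longrightarrow> Ck_on k S f"
proof (induction k arbitrary: f)
  case 0
  then show ?case
    by (auto intro!: continuous_at_imp_continuous_on differentiable_imp_continuous_within)
qed auto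

lemma Ck_on_const: "Ck_on k S (\<lambda>_. c)"
  by (induction k arbitrary: c) auto

lemma Ck_on_add:
  assumes "open S" "Ck_on k S f" "Ck_on k S g"
  shows "Ck_on k S (\<lambda>x. f x + g x)"
  using assms(2,3)
proof (induction k arbitrary: f g)
  case 0
  then show ?case by (auto intro: continuous_on_add)
next
  case (Suc k)
  have D: "((\<lambda>x. f x + g x) has_derivative
      (\<lambda>v. frechet_derivative f (at x) v + frechet_derivative g (at x) v)) (at x)" if "x \<in> S" for x
    using Suc.prems that by (auto intro!: has_derivative_add simp: frechet_derivative_works)
  have "Ck_on k S (\<lambda>x. frechet_derivative (\<lambda>x. f x + g x) (at x) v)" for v
  proof (rule Ck_on_cong[OF \<open>open S\<close>])
    show "Ck_on k S (\<lambda>x. frechet_derivative f (at x) v + frechet_derivative g (at x) v)"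
      using Suc by auto
  qed (simp add: frechet_derivative_at[OF D, symmetric])
  then show ?case
    using D by (auto simp: differentiable_def)
qed

lemma Ck_on_mult:
  fixes f g :: "'a::real_normed_vector \<Rightarrow> 'b::real_normed_algebra"
  assumes "open S" "Ck_on k S f" "Ck_on k S g"
  shows "Ck_on k S (\<lambda>x. f x * g x)"
  using assms(2,3)
proof (induction k arbitrary: f g)
  case 0
  then show ?case by (auto intro: continuous_on_mult)
next
  case (Suc k)
  have D: "((\<lambda>x. f x * g x) has_derivative
      (\<lambda>v. f x * frechet_derivative g (at x) v + frechet_derivative f (at x) v * g x)) (at x)"
    if "x \<in> S" for x
    using Suc.prems that by (auto intro!: has_derivative_mult simp: frechet_derivative_works)
  have "Ck_on k S (\<lambda>x. frechet_derivative (\<lambda>x. f x * g x) (at x) v)" for v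
  proof (rule Ck_on_cong[OF \<open>open S\<close>])
    show "Ck_on k S (\<lambda>x. f x * frechet_derivative g (at x) v + frechet_derivative f (at x) v * g x)"
      using Suc.prems
      \<comment> \<open>The product rule keeps one factor undifferentiated, and that factor enters
        the induction hypothesis at the lower order.\<close>
      by (intro Ck_on_add Suc.IH \<open>open S\<close> Ck_on_Suc_imp[OF Suc.prems(1)] Ck_on_Suc_imp[OF
        Suc.prems(2)])
        auto
  qed (simp add: frechet_derivative_at[OF D, symmetric])
  then show ?case
    using D by (auto simp: differentiable_def)
qed

section \<open>The module of vector fields over the smooth functions\<close>

lemma fscale_add_right [simp]: "f \<star> (X + Y) = f \<star> X + f \<star> Y"
  and fscale_add_left: "(f + f') \<star> X = f \<star> X + f' \<star> X"
  and fscale_diff_right [simp]: "f \<star> (X - Y) = f \<star> X - f \<star> Y"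
  and fscale_minus_right [simp]: "f \<star> (- X) = - (f \<star> X)"
  and fscale_assoc: "f \<star> (f' \<star> X) = (f * f') \<star> X"
  and fscale_zero [simp]: "f \<star> 0 = 0" "0 \<star> X = 0"
  by (auto simp: fscale_def fun_eq_iff algebra_simps)

lemma fscale_apply: "(f \<star> X) u p = f p * X u p"
  by (simp add: fscale_def)

lemma value_at_add: "value_at (X + Y) p = value_at X p + value_at Y p"
  and value_at_diff: "value_at (X - Y) p = value_at X p - value_at Y p"
  and value_at_fscale: "value_at (f \<star> X) p = (\<lambda>u. f p * value_at X p u)"
  and value_at_zero: "value_at 0 p = 0"
  by (auto simp: value_at_def fscale_def)

lemma eq_0_iff_value_at: "X = 0 \<longleftrightarrow> (\<forall>p. value_at X p = 0)"
  by (auto simp: value_at_def fun_eq_iff)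

lemma torsion_swap: "torsion D Y X = - torsion D X Y"
  by (auto simp: torsion_def lie_bracket_def fun_eq_iff)

locale manifold =
  fixes A :: "('m::{t2_space, second_countable_topology}, 'e::euclidean_space) atlas"
  assumes atlas: "smooth_atlas A"
begin

abbreviation C where "C \<equiv> smooth_fun A"
abbreviation V where "V \<equiv> vector_fields A"

lemma smooth_fun_const [simp]: "(\<lambda>_. c) \<in> C"
  by (auto simp: smooth_fun_def smooth_on_def o_def Ck_on_const)

lemma smooth_fun_0 [simp]: "0 \<in> C" and smooth_fun_1 [simp]: "1 \<in> C"
  unfolding zero_fun_def one_fun_def by simp_all

lemma open_chart_image: "(U, x) \<in> A \<Longrightarrow> open (x ` U)"
  using atlas by (auto simp: smooth_atlas_def)

lemma smooth_fun_add [simp]: "f \<in> C \<Longrightarrow> f' \<in> C \<Longrightarrow> f + f' \<in> C"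
  and smooth_fun_mult [simp]: "f \<in> C \<Longrightarrow> f' \<in> C \<Longrightarrow> f * f' \<in> C"
  using open_chart_image
  by (fastforce simp: smooth_fun_def smooth_on_def o_def intro: Ck_on_add Ck_on_mult)+

lemma smooth_fun_minus [simp]: "f \<in> C \<Longrightarrow> - f \<in> C"
proof -
  assume "f \<in> C"
  then have "(\<lambda>_. -1) * f \<in> C" by simp
  also have "(\<lambda>_. -1) * f = - f" by (auto simp: fun_eq_iff)
  finally show ?thesis .
qed

lemma smooth_fun_diff [simp]: "f \<in> C \<Longrightarrow> f' \<in> C \<Longrightarrow> f - f' \<in> C"
  using smooth_fun_add[of f "- f'"] by simp

lemma vf_smooth: "X \<in> V \<Longrightarrow> f \<in> C \<Longrightarrow> X f \<in> C"
  and vf_plus: "X \<in> V \<Longrightarrow> f \<in> C \<Longrightarrow> f' \<in> C \<Longrightarrow> X (f + f') = X f + X f'"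
  and vf_times: "X \<in> V \<Longrightarrow> f \<in> C \<Longrightarrow> f' \<in> C \<Longrightarrow> X (f * f') = f * X f' + f' * X f"
  and vf_nonsmooth: "X \<in> V \<Longrightarrow> f \<notin> C \<Longrightarrow> X f = 0"
  unfolding vector_fields_def by blast+

lemma vf_const:
  assumes "X \<in> V"
  shows "X (\<lambda>_. c) = 0"
proof -
  have cmult: "X (\<lambda>p. c * f p) = (\<lambda>p. c * X f p)" if "f \<in> C" for f c
    using assms that unfolding vector_fields_def by blast
  have "X 1 = X 1 + X 1"
    using vf_times[OF assms smooth_fun_1 smooth_fun_1] by simp
  then have "X 1 = 0" by simp
  then show ?thesis
    using cmult[OF smooth_fun_1, of c] by (simp add: fun_eq_iff)
qed

lemma vf_0: "X \<in> V \<Longrightarrow> X 0 = 0" and vf_1: "X \<in> V \<Longrightarrow> X 1 = 0"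
  using vf_const[of X 0] vf_const[of X 1] by (simp_all add: zero_fun_def one_fun_def)

lemma vf_minus:
  assumes "X \<in> V" "f \<in> C"
  shows "X (- f) = - X f"
proof -
  have "X (f + - f) = X f + X (- f)"
    by (rule vf_plus[OF assms]) (use assms(2) in simp)
  then show ?thesis
    by (simp add: vf_0[OF assms(1)] minus_unique)
qed

lemma vf_diff: "X \<in> V \<Longrightarrow> f \<in> C \<Longrightarrow> f' \<in> C \<Longrightarrow> X (f - f') = X f - X f'"
  using vf_plus[of X f "- f'"] vf_minus[of X f'] by simp

lemmas vf_simps = vf_smooth vf_plus vf_times vf_const vf_0 vf_1 vf_minus vf_diff vf_nonsmooth

text \<open>Real homogeneity is the Leibniz rule with one constant factor, once constants are
  killed; the latter is easier to check for sums, multiples and brackets.\<close>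

lemma vfI:
  assumes "\<And>f. f \<in> C \<Longrightarrow> X f \<in> C"
    and "\<And>f f'. f \<in> C \<Longrightarrow> f' \<in> C \<Longrightarrow> X (f + f') = X f + X f'"
    and "\<And>f f'. f \<in> C \<Longrightarrow> f' \<in> C \<Longrightarrow> X (f * f') = f * X f' + f' * X f"
    and "\<And>c. X (\<lambda>_. c) = 0"
    and "\<And>f. f \<notin> C \<Longrightarrow> X f = 0"
  shows "X \<in> V"
proof -
  have "X (\<lambda>p. c * f p) = (\<lambda>p. c * X f p)" if "f \<in> C" for f c
    using assms(3)[OF smooth_fun_const[of c] that] assms(4)[of c]
    by (simp add: times_fun_def fun_eq_iff)
  then show ?thesis
    unfolding vector_fields_def using assms by blast
qed

lemma vf_add [simp]: "X \<in> V \<Longrightarrow> Y \<in> V \<Longrightarrow> X + Y \<in> V"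
proof -
  assume X: "X \<in> V" and Y: "Y \<in> V"
  show ?thesis
    by (intro vfI) (auto simp: vf_simps[OF X] vf_simps[OF Y] fun_eq_iff algebra_simps)
qed

lemma vf_fscale [simp]: "f \<in> C \<Longrightarrow> X \<in> V \<Longrightarrow> f \<star> X \<in> V"
proof -
  assume f: "f \<in> C" and X: "X \<in> V"
  show ?thesis
    by (intro vfI) (auto simp: fscale_def vf_simps[OF X] f algebra_simps)
qed

lemma vf_uminus [simp]: "X \<in> V \<Longrightarrow> - X \<in> V"
proof -
  assume X: "X \<in> V"
  show ?thesis
    by (intro vfI) (auto simp: vf_simps[OF X] algebra_simps)
qed

lemma vf_subtract [simp]: "X \<in> V \<Longrightarrow> Y \<in> V \<Longrightarrow> X - Y \<in> V"
  using vf_add[of X "- Y"] by simp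

lemma vf_zero [simp]: "0 \<in> V"
  by (intro vfI) auto

lemma vf_lie [simp]: "X \<in> V \<Longrightarrow> Y \<in> V \<Longrightarrow> lie_bracket X Y \<in> V"
proof -
  assume X: "X \<in> V" and Y: "Y \<in> V"
  show ?thesis
    by (intro vfI) (auto simp: lie_bracket_def vf_simps[OF X] vf_simps[OF Y] algebra_simps)
qed

text \<open>Vector fields are 0 off \<open>C\<close> by convention, so testing on \<open>C\<close>,
  where the derivation rules hold, gives equality as HOL functions.\<close>

lemma vf_eqI: "X \<in> V \<Longrightarrow> Y \<in> V \<Longrightarrow> (\<And>f. f \<in> C \<Longrightarrow> X f = Y f) \<Longrightarrow> X = Y"
  by (rule ext) (metis vf_nonsmooth)

lemma lie_swap: "lie_bracket Y X = - lie_bracket X Y"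
  by (auto simp: lie_bracket_def fun_eq_iff)

lemma lie_add_right:
  assumes X: "X \<in> V" and X': "X' \<in> V" and Y: "Y \<in> V"
  shows "lie_bracket Y (X + X') = lie_bracket Y X + lie_bracket Y X'"
  by (rule vf_eqI)
    (simp_all add: assms, simp add: lie_bracket_def vf_simps[OF X] vf_simps[OF X'] vf_simps[OF Y])

lemma lie_scale_right:
  assumes X: "X \<in> V" and Y: "Y \<in> V" and f: "f \<in> C"
  shows "lie_bracket Y (f \<star> X) = f \<star> lie_bracket Y X + Y f \<star> X"
  by (rule vf_eqI)
    (simp_all add: assms vf_smooth,
      simp add: lie_bracket_def fscale_def f vf_simps[OF X] vf_simps[OF Y] algebra_simps)

lemma jacobi:
  assumes X: "X \<in> V" and Y: "Y \<in> V" and Z: "Z \<in> V"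
  shows "lie_bracket (lie_bracket X Y) Z =
      - lie_bracket (lie_bracket Y Z) X - lie_bracket (lie_bracket Z X) Y"
  by (rule vf_eqI)
    (simp_all add: assms, simp add: lie_bracket_def vf_simps[OF X] vf_simps[OF Y] vf_simps[OF Z])

section \<open>Tensor fields and connections\<close>

lemma one_form_smooth: "one_form A \<omega> \<Longrightarrow> X \<in> V \<Longrightarrow> \<omega> X \<in> C"
  and one_form_add: "one_form A \<omega> \<Longrightarrow> X \<in> V \<Longrightarrow> Y \<in> V \<Longrightarrow> \<omega> (X + Y) = \<omega> X + \<omega> Y"
  and one_form_scale: "one_form A \<omega> \<Longrightarrow> X \<in> V \<Longrightarrow> f \<in> C \<Longrightarrow> \<omega> (f \<star> X) = f * \<omega> X"
  by (auto simp: one_form_def)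

lemma one_form_uminus:
  assumes "one_form A \<omega>" "X \<in> V"
  shows "\<omega> (- X) = - \<omega> X"
proof -
  have "- X = (\<lambda>_. -1) \<star> X" by (auto simp: fscale_def fun_eq_iff)
  then have "\<omega> (- X) = (\<lambda>_. -1) * \<omega> X" by (simp add: one_form_scale[OF assms])
  also have "\<dots> = - \<omega> X" by (auto simp: fun_eq_iff)
  finally show ?thesis .
qed

lemma one_form_diff: "one_form A \<omega> \<Longrightarrow> X \<in> V \<Longrightarrow> Y \<in> V \<Longrightarrow> \<omega> (X - Y) = \<omega> X - \<omega> Y"
  using one_form_add[of \<omega> X "- Y"] one_form_uminus[of \<omega> Y] by simp

lemma one_form_zero: "one_form A \<omega> \<Longrightarrow> \<omega> 0 = 0"
  using one_form_scale[of \<omega> 0 0] by simp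

lemmas one_form_simps =
  one_form_smooth one_form_add one_form_scale one_form_uminus one_form_diff one_form_zero

lemma tensor11_vf: "tensor11 A \<phi> \<Longrightarrow> X \<in> V \<Longrightarrow> \<phi> X \<in> V"
  and tensor11_add: "tensor11 A \<phi> \<Longrightarrow> X \<in> V \<Longrightarrow> Y \<in> V \<Longrightarrow> \<phi> (X + Y) = \<phi> X + \<phi> Y"
  and tensor11_scale: "tensor11 A \<phi> \<Longrightarrow> X \<in> V \<Longrightarrow> f \<in> C \<Longrightarrow> \<phi> (f \<star> X) = f \<star> \<phi> X"
  by (auto simp: tensor11_def)

lemma tensor11_uminus: "tensor11 A \<phi> \<Longrightarrow> X \<in> V \<Longrightarrow> \<phi> (- X) = - \<phi> X"
proof -
  assume *: "tensor11 A \<phi>" "X \<in> V"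
  have "- X = (\<lambda>_. -1) \<star> X" for X :: "'m vfield" by (auto simp: fscale_def fun_eq_iff)
  then show ?thesis using tensor11_scale[OF *, of "\<lambda>_. -1"] by simp
qed

lemma tensor11_diff: "tensor11 A \<phi> \<Longrightarrow> X \<in> V \<Longrightarrow> Y \<in> V \<Longrightarrow> \<phi> (X - Y) = \<phi> X - \<phi> Y"
  using tensor11_add[of \<phi> X "- Y"] tensor11_uminus[of \<phi> Y] by simp

lemma tensor11_zero: "tensor11 A \<phi> \<Longrightarrow> \<phi> 0 = 0"
  using tensor11_scale[of \<phi> 0 0] by simp

lemmas tensor11_simps =
  tensor11_vf tensor11_add tensor11_scale tensor11_uminus tensor11_diff tensor11_zero

text \<open>Written in the algebra of functions, so that the rules for derivations and one-forms
  apply as rewrite rules.\<close>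

lemma ext_d_altdef: "ext_d \<eta> X Y = (\<lambda>_. 1/2) * (X (\<eta> Y) - Y (\<eta> X) - \<eta> (lie_bracket X Y))"
  by (simp add: ext_d_def fun_eq_iff)

context
  fixes \<eta> assumes \<eta>: "one_form A \<eta>"
begin

lemma ext_d_swap: "X \<in> V \<Longrightarrow> Y \<in> V \<Longrightarrow> ext_d \<eta> Y X = - ext_d \<eta> X Y"
  by (simp add: ext_d_altdef lie_swap[of Y X] one_form_simps[OF \<eta>] algebra_simps)

text \<open>For linearity over \<open>C\<close>, the term \<open>X f * \<eta> Y\<close> from
  differentiating \<open>f * \<eta> Y\<close> cancels against the one from the bracket.\<close>

lemma one_form_ext_d:
  assumes X: "X \<in> V"
  shows "one_form A (ext_d \<eta> X)"
  unfolding one_form_def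
proof (intro conjI ballI)
  fix Y assume Y: "Y \<in> V"
  note s = one_form_simps[OF \<eta>] vf_simps[OF X] vf_simps[OF Y] X Y
  show "ext_d \<eta> X Y \<in> C"
    by (simp add: ext_d_altdef s)
  show "ext_d \<eta> X (Y + Z) = ext_d \<eta> X Y + ext_d \<eta> X Z" if Z: "Z \<in> V" for Z
    by (simp add: ext_d_altdef lie_add_right s Z vf_simps[OF Z] algebra_simps)
  show "ext_d \<eta> X (f \<star> Y) = f * ext_d \<eta> X Y" if f: "f \<in> C" for f
    by (simp add: ext_d_altdef lie_scale_right s f fun_cong[OF fscale_def] algebra_simps)
qed

text \<open>This is d(d\<eta>) = 0: second derivatives combine into commutators, and the double
  brackets cancel by the Jacobi identity.\<close>

lemma ext_d_closed:
  assumes X: "X \<in> V" and Y: "Y \<in> V" and Z: "Z \<in> V"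
  shows "X (ext_d \<eta> Y Z) + Y (ext_d \<eta> Z X) + Z (ext_d \<eta> X Y) =
    ext_d \<eta> (lie_bracket X Y) Z + ext_d \<eta> (lie_bracket Y Z) X + ext_d \<eta> (lie_bracket Z X) Y"
proof -
  have J: "\<eta> (lie_bracket (lie_bracket X Y) Z) =
      - \<eta> (lie_bracket (lie_bracket Y Z) X) - \<eta> (lie_bracket (lie_bracket Z X) Y)"
    by (simp add: jacobi[OF X Y Z] one_form_simps[OF \<eta>] X Y Z)
  have l: "lie_bracket X Y f = X (Y f) - Y (X f)" for X Y :: "'m vfield" and f
    by (simp add: lie_bracket_def)
  show ?thesis
    unfolding ext_d_altdef
    by (simp add: J one_form_simps[OF \<eta>] X Y Z vf_simps[OF X] vf_simps[OF Y] vf_simps[OF Z])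
      (simp add: l algebra_simps)
qed

end

section \<open>Rules for linear connections\<close>

lemma linear_connectionD:
  assumes "linear_connection A D"
  shows linear_connection_vf: "X \<in> V \<Longrightarrow> Y \<in> V \<Longrightarrow> D X Y \<in> V"
    and linear_connection_add_left: "X \<in> V \<Longrightarrow> X' \<in> V \<Longrightarrow> Y \<in> V \<Longrightarrow> D (X + X') Y = D X Y + D X' Y"
    and linear_connection_scale_left: "X \<in> V \<Longrightarrow> Y \<in> V \<Longrightarrow> f \<in> C \<Longrightarrow> D (f \<star> X) Y = f \<star> D X Y"
    and linear_connection_uminus_left: "X \<in> V \<Longrightarrow> Y \<in> V \<Longrightarrow> D (- X) Y = - D X Y"
    and linear_connection_diff_left: "X \<in> V \<Longrightarrow> X' \<in> V \<Longrightarrow> Y \<in> V \<Longrightarrow> D (X - X') Y = D X Y - D X' Y"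
    and linear_connection_add_right: "X \<in> V \<Longrightarrow> Y \<in> V \<Longrightarrow> Y' \<in> V \<Longrightarrow> D X (Y + Y') = D X Y + D X Y'"
    and linear_connection_scale_right: "X \<in> V \<Longrightarrow> Y \<in> V \<Longrightarrow> f \<in> C \<Longrightarrow> D X (f \<star> Y) = f \<star> D X Y + X f \<star> Y"
    and linear_connection_uminus_right: "X \<in> V \<Longrightarrow> Y \<in> V \<Longrightarrow> D X (- Y) = - D X Y"
    and linear_connection_diff_right: "X \<in> V \<Longrightarrow> Y \<in> V \<Longrightarrow> Y' \<in> V \<Longrightarrow> D X (Y - Y') = D X Y - D X Y'"
proof -
  have t: "Y \<in> V \<Longrightarrow> tensor11 A (\<lambda>X. D X Y)" for Y
    using assms by (auto simp: linear_connection_def)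
  show "X \<in> V \<Longrightarrow> Y \<in> V \<Longrightarrow> D X Y \<in> V"
    by (rule tensor11_vf[OF t])
  show "X \<in> V \<Longrightarrow> X' \<in> V \<Longrightarrow> Y \<in> V \<Longrightarrow> D (X + X') Y = D X Y + D X' Y"
    by (rule tensor11_add[OF t])
  show "X \<in> V \<Longrightarrow> Y \<in> V \<Longrightarrow> f \<in> C \<Longrightarrow> D (f \<star> X) Y = f \<star> D X Y"
    by (rule tensor11_scale[OF t])
  show "X \<in> V \<Longrightarrow> Y \<in> V \<Longrightarrow> D (- X) Y = - D X Y"
    by (rule tensor11_uminus[OF t])
  show "X \<in> V \<Longrightarrow> X' \<in> V \<Longrightarrow> Y \<in> V \<Longrightarrow> D (X - X') Y = D X Y - D X' Y"
    by (rule tensor11_diff[OF t])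
  show add: "X \<in> V \<Longrightarrow> Y \<in> V \<Longrightarrow> Y' \<in> V \<Longrightarrow> D X (Y + Y') = D X Y + D X Y'"
    and scale: "X \<in> V \<Longrightarrow> Y \<in> V \<Longrightarrow> f \<in> C \<Longrightarrow> D X (f \<star> Y) = f \<star> D X Y + X f \<star> Y"
    for X Y Y' f
    using assms by (auto simp: linear_connection_def)
  have um: "D X (- Y) = - D X Y" if XY: "X \<in> V" "Y \<in> V" for X Y
  proof -
    have m: "- Y = (\<lambda>_. -1) \<star> Y" for Y :: "'m vfield" by (auto simp: fscale_def fun_eq_iff)
    show ?thesis
      using scale[OF XY smooth_fun_const[of "-1"]] m[of Y] m[of "D X Y"] vf_const[OF XY(1), of "-1"]
      by simp
  qed
  then show "X \<in> V \<Longrightarrow> Y \<in> V \<Longrightarrow> D X (- Y) = - D X Y" .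
  show "X \<in> V \<Longrightarrow> Y \<in> V \<Longrightarrow> Y' \<in> V \<Longrightarrow> D X (Y - Y') = D X Y - D X Y'"
    using add[of X Y "- Y'"] um[of X Y'] by simp
qed

end

section \<open>Contact metric structures with an adapted connection\<close>

text \<open>Isolates the curvature computation from the foliations: everything follows from a
  connection that makes the structure parallel and has torsion explicit in \<phi> and
  \<open>h\<close>. Here \<open>h\<close> is only an abstract tensor; \<open>h_tensor_eq\<close>
  identifies it with half the Lie derivative of \<phi>.\<close>

locale adapted_connection = manifold A
  for A :: "('m::{t2_space, second_countable_topology}, 'e::euclidean_space) atlas" +
  fixes \<phi> h :: "'m vfield \<Rightarrow> 'm vfield" and \<xi> :: "'m vfield"
    and \<eta> :: "'m vfield \<Rightarrow> 'm \<Rightarrow> real" and g :: "'m vfield \<Rightarrow> 'm vfield \<Rightarrow> 'm \<Rightarrow> real"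
    and D :: "'m vfield \<Rightarrow> 'm vfield \<Rightarrow> 'm vfield" and k l :: real
  assumes contact_metric: "contact_metric_structure A \<phi> \<xi> \<eta> g"
    and h_tensor11: "tensor11 A h"
    and h_xi [simp]: "h \<xi> = 0"
    and h_phi: "X \<in> V \<Longrightarrow> h (\<phi> X) = - \<phi> (h X)"
    and h_h: "X \<in> V \<Longrightarrow> h (h X) = (\<lambda>_. l) \<star> (X - \<eta> X \<star> \<xi>)"
    and g_h: "X \<in> V \<Longrightarrow> Y \<in> V \<Longrightarrow> g (h X) Y = g X (h Y)"
    and D_connection: "linear_connection A D"
    and D_xi [simp]: "X \<in> V \<Longrightarrow> D X \<xi> = 0"
    and D_phi: "X \<in> V \<Longrightarrow> Y \<in> V \<Longrightarrow> D X (\<phi> Y) = \<phi> (D X Y)"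
    and D_h: "X \<in> V \<Longrightarrow> Y \<in> V \<Longrightarrow> D X (h Y) = h (D X Y)"
    and D_g: "X \<in> V \<Longrightarrow> Y \<in> V \<Longrightarrow> Z \<in> V \<Longrightarrow> cov_deriv2 D g Z X Y = 0"
    and torsion_D: "X \<in> V \<Longrightarrow> Y \<in> V \<Longrightarrow> torsion D X Y =
      ((\<lambda>_. 2) * ext_d \<eta> X Y) \<star> \<xi> + \<eta> Y \<star> ((\<lambda>_. k) \<star> \<phi> X + \<phi> (h X))
        - \<eta> X \<star> ((\<lambda>_. k) \<star> \<phi> Y + \<phi> (h Y))"
begin

lemma eta_form: "one_form A \<eta>" and phi_tensor11: "tensor11 A \<phi>"
  and g_metric: "riemannian_metric A g" and xi_reeb: "reeb_field A \<eta> \<xi>"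
  using contact_metric by (simp_all add: contact_metric_structure_def)

lemma xi_vf [simp]: "\<xi> \<in> V" and eta_xi [simp]: "\<eta> \<xi> = 1"
  using xi_reeb by (simp_all add: reeb_field_def)

lemmas [simp] = one_form_simps[OF eta_form] tensor11_simps[OF phi_tensor11]
  tensor11_simps[OF h_tensor11] linear_connectionD[OF D_connection]

lemma g_form: "X \<in> V \<Longrightarrow> one_form A (g X)"
  and g_sym: "X \<in> V \<Longrightarrow> Y \<in> V \<Longrightarrow> g X Y = g Y X"
  using g_metric by (simp_all add: riemannian_metric_def)

lemmas g_right [simp] = one_form_simps[OF g_form]

lemma g_left [simp]:
  assumes "Z \<in> V"
  shows "X \<in> V \<Longrightarrow> Y \<in> V \<Longrightarrow> g (X + Y) Z = g X Z + g Y Z"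
    and "X \<in> V \<Longrightarrow> f \<in> C \<Longrightarrow> g (f \<star> X) Z = f * g X Z"
    and "X \<in> V \<Longrightarrow> g (- X) Z = - g X Z"
    and "X \<in> V \<Longrightarrow> Y \<in> V \<Longrightarrow> g (X - Y) Z = g X Z - g Y Z"
    and "g 0 Z = 0"
  using assms by (simp_all add: g_sym[of _ Z])

lemma phi_phi: "X \<in> V \<Longrightarrow> \<phi> (\<phi> X) = - X + \<eta> X \<star> \<xi>"
  and g_phi_right: "X \<in> V \<Longrightarrow> Y \<in> V \<Longrightarrow> g X (\<phi> Y) = ext_d \<eta> X Y"
  and g_phi_phi: "X \<in> V \<Longrightarrow> Y \<in> V \<Longrightarrow> g (\<phi> X) (\<phi> Y) = g X Y - \<eta> X * \<eta> Y"
  using contact_metric by (simp_all add: contact_metric_structure_def)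

text \<open>As \<open>\<phi> (\<phi> \<xi>) = 0\<close>, the field \<open>\<phi> \<xi>\<close> is a
  multiple \<open>f \<star> \<xi>\<close>; applying \<phi> and then \<eta> gives
  \<open>f * f = 0\<close>, hence \<open>f = 0\<close>.\<close>

lemma phi_xi [simp]: "\<phi> \<xi> = 0"
proof -
  have 0: "\<phi> (\<phi> \<xi>) = 0"
    by (simp add: phi_phi fun_eq_iff fscale_apply)
  have 1: "\<phi> \<xi> = \<eta> (\<phi> \<xi>) \<star> \<xi>"
    using phi_phi[of "\<phi> \<xi>"] by (simp add: 0)
  then have "\<phi> (\<phi> \<xi>) = \<eta> (\<phi> \<xi>) \<star> \<phi> \<xi>"
    using tensor11_scale[OF phi_tensor11 xi_vf, of "\<eta> (\<phi> \<xi>)"] by simp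
  with 0 have "\<eta> (\<eta> (\<phi> \<xi>) \<star> \<phi> \<xi>) = 0" by simp
  then have "\<eta> (\<phi> \<xi>) * \<eta> (\<phi> \<xi>) = 0" by simp
  then have "\<eta> (\<phi> \<xi>) = 0" by (simp add: fun_eq_iff)
  with 1 show ?thesis by simp
qed

lemma g_xi [simp]:
  assumes "X \<in> V"
  shows "g X \<xi> = \<eta> X" and "g \<xi> X = \<eta> X"
proof -
  show 1: "g X \<xi> = \<eta> X"
    using g_phi_phi[OF assms xi_vf] by (simp add: assms)
  show "g \<xi> X = \<eta> X"
    unfolding g_sym[OF xi_vf assms] by (rule 1)
qed

text \<open>The left side is \<open>g \<xi> (\<phi> X) = ext_d \<eta> \<xi> X\<close>, which
  vanishes for the Reeb field.\<close>

lemma eta_phi [simp]: "X \<in> V \<Longrightarrow> \<eta> (\<phi> X) = 0"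
  using g_phi_right[of \<xi> X] xi_reeb by (simp add: reeb_field_def)

lemma eta_h [simp]: "X \<in> V \<Longrightarrow> \<eta> (h X) = 0"
  using g_h[of X \<xi>] by simp

lemma g_phi_left:
    "X \<in> V \<Longrightarrow> Y \<in> V \<Longrightarrow> g (\<phi> X) Y = - ext_d \<eta> X Y"
  by (simp add: g_sym[of "\<phi> X" Y] g_phi_right ext_d_swap[OF eta_form, of X Y])

text \<open>The tensor \<open>h\<close> is read off the torsion since \<open>D\<^sub>\<xi> \<phi> = 0\<close>.\<close>

lemma lie_xi: "X \<in> V \<Longrightarrow>
    lie_bracket \<xi> X = D \<xi> X + (\<lambda>_. k) \<star> \<phi> X + \<phi> (h X)"
proof -
  assume X: "X \<in> V"
  have "ext_d \<eta> \<xi> X = 0" using X xi_reeb by (simp add: reeb_field_def)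
  then have "torsion D \<xi> X = - ((\<lambda>_. k) \<star> \<phi> X + \<phi> (h X))"
    by (simp add: torsion_D X) (simp add: fun_eq_iff fscale_apply)
  then have "D \<xi> X - lie_bracket \<xi> X = - ((\<lambda>_. k) \<star> \<phi> X + \<phi> (h X))"
    by (simp add: torsion_def X)
  then show ?thesis by (simp add: algebra_simps)
qed

text \<open>In \<open>[\<xi>, \<phi> X] - \<phi> [\<xi>, X]\<close> the terms with \<open>D\<close>
  and \<open>k\<close> cancel. By \<open>h_phi\<close> the rest is
  \<open>- 2 \<phi> (\<phi> (h X))\<close>, which is \<open>2 h X\<close> because \<eta> vanishes on
  \<open>h X\<close>.\<close>

lemma h_tensor_eq: "X \<in> V \<Longrightarrow> h_tensor \<phi> \<xi> X = h X"
  unfolding h_tensor_def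
  by (simp add: lie_xi D_phi h_phi phi_phi) (simp add: fun_eq_iff fscale_apply)

section \<open>The Levi-Civita connection and its curvature on \<xi>\<close>

definition N :: "'m vfield \<Rightarrow> 'm vfield" where
  "N X = \<phi> X + \<phi> (h X)"

text \<open>The correction term is forced by \<open>\<nabla>\<^sub>X \<xi> = - \<phi> X - \<phi> h X\<close>, metricity and the torsion of \<open>D\<close>.\<close>

definition LC :: "'m vfield \<Rightarrow> 'm vfield \<Rightarrow> 'm vfield" where
  "LC X Y = D X Y + g Y (N X) \<star> \<xi> - \<eta> Y \<star> N X + ((\<lambda>_. k - 1) * \<eta> X) \<star> \<phi> Y"

lemma N_tensor11: "tensor11 A N"
  unfolding tensor11_def N_def by (simp add: algebra_simps)

lemmas [simp] = tensor11_simps[OF N_tensor11]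

lemma eta_N [simp]: "X \<in> V \<Longrightarrow> \<eta> (N X) = 0"
  by (simp add: N_def)

lemma D_N: "X \<in> V \<Longrightarrow> Y \<in> V \<Longrightarrow> D X (N Y) = N (D X Y)"
  by (simp add: N_def D_phi D_h)

lemma LC_linear_connection: "linear_connection A LC"
  unfolding linear_connection_def tensor11_def LC_def
  by (auto simp: fscale_add_left) (auto simp: fun_eq_iff fscale_apply algebra_simps)

text \<open>For a fixed direction \<open>Z\<close>, both corrections are skew for \<open>g\<close>
  as endomorphisms: one is the infinitesimal rotation in \<xi> and \<open>N Z\<close>, the other a
  multiple of \<phi>, and \<open>g X (\<phi> Y)\<close> is alternating.\<close>

lemma LC_metric:
  assumes X: "X \<in> V" and Y: "Y \<in> V" and Z: "Z \<in> V"
  shows "cov_deriv2 LC g Z X Y = 0"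
proof -
  have "Z (g X Y) = g (D Z X) Y + g X (D Z Y)"
    using D_g[OF X Y Z] by (simp add: cov_deriv2_def algebra_simps)
  then show ?thesis
    unfolding cov_deriv2_def LC_def
    by (simp add: X Y Z g_phi_left g_phi_right g_sym[of "N Z" Y] algebra_simps)
qed

text \<open>As \<phi> is skew and \<open>\<phi> \<circ> h\<close> symmetric for \<open>g\<close>,
  the antisymmetrised \<xi>-term is \<open>- 2 d\<eta>(X,Y) \<xi>\<close>, cancelling that part of
  the torsion of \<open>D\<close>. In the coefficient of \<open>\<eta> Y\<close> one has
  \<open>k \<phi> + \<phi> h - N - (k - 1) \<phi> = 0\<close>.\<close>

lemma LC_torsion:
  assumes X: "X \<in> V" and Y: "Y \<in> V"
  shows "torsion LC X Y = 0"
proof -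
  have "g Y (N X) - g X (N Y) = - ((\<lambda>_. 2) * ext_d \<eta> X Y)"
  proof -
    have "g Y (\<phi> (h X)) = g X (\<phi> (h Y))"
      using g_h[of X "\<phi> Y"] by (simp add: g_sym[of Y "\<phi> (h X)"] X Y g_phi_left g_phi_right h_phi
        ext_d_swap[OF eta_form, of Y "h X"] ext_d_swap[OF eta_form, of X "h Y"])
    then show ?thesis
      by (simp add: N_def X Y g_phi_right ext_d_swap[OF eta_form, of X Y] fun_eq_iff)
  qed
  then have "g Y (N X) = g X (N Y) - (\<lambda>_. 2) * ext_d \<eta> X Y"
    by (simp add: algebra_simps)
  moreover have "torsion LC X Y = torsion D X Y + (g Y (N X) - g X (N Y)) \<star> \<xi>
    - \<eta> Y \<star> N X + \<eta> X \<star> N Y + ((\<lambda>_. k - 1) * \<eta> X) \<star> \<phi> Y - ((\<lambda>_. k - 1) * \<eta> Y) \<star> \<phi> X"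
    by (simp add: torsion_def LC_def fun_eq_iff fscale_apply algebra_simps)
  ultimately show ?thesis
    by (simp add: torsion_D X Y N_def) (simp add: fun_eq_iff fscale_apply algebra_simps)
qed

lemma levi_civita_LC: "levi_civita A g LC"
  unfolding levi_civita_def
  using LC_linear_connection LC_torsion LC_metric by blast

lemma LC_xi: "X \<in> V \<Longrightarrow> LC X \<xi> = - N X"
  by (simp add: LC_def) (simp add: fun_eq_iff fscale_apply)

lemma curvature_LC_xi:
  assumes X: "X \<in> V" and Y: "Y \<in> V"
  shows "curvature LC X Y \<xi> = (\<lambda>_. 1 - l) \<star> (\<eta> Y \<star> X - \<eta> X \<star> Y) +
    (\<lambda>_. 2 - 2 * k) \<star> (\<eta> Y \<star> h X - \<eta> X \<star> h Y)"
proof -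
  note LC = linear_connectionD[OF LC_linear_connection]
  have lie: "lie_bracket X Y = D X Y - D Y X - torsion D X Y"
    by (simp add: torsion_def)
  have ext: "ext_d \<eta> X Y \<in> C"
    using one_form_smooth[OF one_form_ext_d[OF eta_form X] Y] .
  have N\<xi>: "N \<xi> = 0" by (simp add: N_def)
  have "curvature LC X Y \<xi> = LC Y (N X) - LC X (N Y) + N (lie_bracket X Y)"
    unfolding curvature_def by (simp add: LC_xi X Y LC)
  \<comment> \<open>Since \<open>N\<close> is \<open>D\<close>-parallel, the derivatives combine
    with the bracket into \<open>N\<close> of the torsion; the terms along \<xi> cancel by symmetry
    of \<open>g (N X) (N Y)\<close>.\<close>
  also have "\<dots> = ((\<lambda>_. k - 1) * \<eta> Y) \<star> \<phi> (N X) - ((\<lambda>_. k - 1) * \<eta> X) \<star> \<phi> (N Y)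
      - N (torsion D X Y)"
    unfolding lie by (simp add: LC_def D_N X Y g_sym[of "N Y" "N X"] torsion_def)
  also have "\<dots> = (\<lambda>_. 1 - l) \<star> (\<eta> Y \<star> X - \<eta> X \<star> Y) +
    (\<lambda>_. 2 - 2 * k) \<star> (\<eta> Y \<star> h X - \<eta> X \<star> h Y)"
    \<comment> \<open>\<open>N \<xi> = 0\<close> removes the d\<eta>-part of the torsion. With
      \<open>h \<phi> = - \<phi> h\<close> and \<open>h h = l\<close> off \<xi>, \<open>N\<close>
      takes \<open>k \<phi> X + \<phi> (h X)\<close> to \<open>(l - k) X + (k - 1) h X\<close>, up
      to multiples of \<xi> that cancel.\<close>
    unfolding torsion_D[OF X Y]
    by (simp add: X Y ext N\<xi>) (simp add: N_def X Y phi_phi h_phi h_h, simp add: fun_eq_iff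
      fscale_apply algebra_simps)
  finally show ?thesis .
qed

lemma kappa_mu: "kappa_mu_manifold (1 - l) (2 - 2 * k) A \<phi> \<xi> \<eta> g"
  unfolding kappa_mu_manifold_def
  using contact_metric levi_civita_LC by (auto simp: curvature_LC_xi h_tensor_eq intro!: exI[of _ LC])

end

section \<open>Subbundles\<close>

lemma sections_value: "X \<in> sections A L \<Longrightarrow> value_at X p \<in> L p"
  by (simp add: sections_def)

context
  fixes n :: nat and A :: "('m::topological_space, 'e::euclidean_space) atlas" and L :: "'m distribution"
  assumes L: "subbundle n A L"
begin

lemma subbundle_frame:
  obtains E where "\<And>i. i < n \<Longrightarrow> E i \<in> sections A L"
    and "L p = {\<lambda>f. \<Sum>i<n. c i * value_at (E i) p f |c. True}"
    and "\<And>c. (\<And>f. (\<Sum>i<n. c i * value_at (E i) p f) = 0) \<Longrightarrow> (\<forall>i<n. c i = 0)"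
proof -
  have "\<exists>U E. open U \<and> p \<in> U \<and> (\<forall>i<n. E i \<in> sections A L) \<and>
        (\<forall>q\<in>U. L q = {\<lambda>f. \<Sum>i<n. c i * value_at (E i) q f |c. True} \<and>
               (\<forall>c. (\<forall>f. (\<Sum>i<n. c i * value_at (E i) q f) = 0) \<longrightarrow> (\<forall>i<n. c i = 0)))"
    using L unfolding subbundle_def by (rule spec)
  then obtain U E where "p \<in> U" and E: "\<forall>i<n. E i \<in> sections A L"
    and U: "\<forall>q\<in>U. L q = {\<lambda>f. \<Sum>i<n. c i * value_at (E i) q f |c. True} \<and>
               (\<forall>c. (\<forall>f. (\<Sum>i<n. c i * value_at (E i) q f) = 0) \<longrightarrow> (\<forall>i<n. c i = 0))"
    by (elim exE conjE)
  show thesis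
    using E bspec[OF U \<open>p \<in> U\<close>] by (intro that[of E]) simp_all
qed

lemma subbundle_zero: "0 \<in> L p"
proof -
  obtain E where "L p = {\<lambda>f. \<Sum>i<n. c i * value_at (E i) p f |c. True}"
    by (rule subbundle_frame[of p])
  then show ?thesis
    by (auto intro!: exI[of _ "\<lambda>_. 0"] simp: fun_eq_iff)
qed

lemma subbundle_add:
  assumes "u \<in> L p" "v \<in> L p"
  shows "u + v \<in> L p"
proof -
  obtain E where E: "L p = {\<lambda>f. \<Sum>i<n. c i * value_at (E i) p f |c. True}"
    by (rule subbundle_frame[of p])
  obtain c d where "u = (\<lambda>f. \<Sum>i<n. c i * value_at (E i) p f)"
    and "v = (\<lambda>f. \<Sum>i<n. d i * value_at (E i) p f)"
    using assms unfolding E by blast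
  then have "u + v = (\<lambda>f. \<Sum>i<n. (c i + d i) * value_at (E i) p f)"
    by (simp add: fun_eq_iff sum.distrib distrib_right)
  then show ?thesis
    unfolding E by (intro CollectI exI[of _ "\<lambda>i. c i + d i"]) simp
qed

lemma subbundle_scale:
  assumes "u \<in> L p"
  shows "(\<lambda>f. r * u f) \<in> L p"
proof -
  obtain E where E: "L p = {\<lambda>f. \<Sum>i<n. c i * value_at (E i) p f |c. True}"
    by (rule subbundle_frame[of p])
  obtain c where "u = (\<lambda>f. \<Sum>i<n. c i * value_at (E i) p f)"
    using assms unfolding E by blast
  then have "(\<lambda>f. r * u f) = (\<lambda>f. \<Sum>i<n. (r * c i) * value_at (E i) p f)"
    by (simp add: fun_eq_iff sum_distrib_left mult.assoc)
  then show ?thesis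
    unfolding E by (intro CollectI exI[of _ "\<lambda>i. r * c i"]) simp
qed

text \<open>Supplies the auxiliary section perturbed in \<open>Pi_nonneg\<close>; a vanishing frame
  field would contradict independence with a unit coefficient vector.\<close>

lemma sections_nonvanishing:
  assumes "n > 0"
  obtains Y where "Y \<in> sections A L" "value_at Y p \<noteq> 0"
proof -
  obtain E where E: "\<And>i. i < n \<Longrightarrow> E i \<in> sections A L"
    and ind: "\<And>c. (\<And>f. (\<Sum>i<n. c i * value_at (E i) p f) = 0) \<Longrightarrow> (\<forall>i<n. c i = 0)"
    by (rule subbundle_frame[of p]) blast
  have "value_at (E 0) p \<noteq> 0"
  proof
    assume "value_at (E 0) p = 0"
    then have "(\<Sum>i<n. (if i = 0 then 1 else 0) * value_at (E i) p f) = 0" for f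
      by (intro sum.neutral) auto
    from ind[OF this] assms show False by auto
  qed
  with E[of 0] assms show thesis by (intro that[of "E 0"]) auto
qed

lemma sections_rank_0:
  assumes "n = 0" "X \<in> sections A L"
  shows "X = 0"
proof -
  have "value_at X p = 0" for p
  proof -
    obtain E where "L p = {\<lambda>f. \<Sum>i<n. c i * value_at (E i) p f |c. True}"
      by (rule subbundle_frame[of p])
    moreover have "value_at X p \<in> L p"
      using assms(2) by (simp add: sections_def)
    ultimately show ?thesis
      using assms(1) by (auto simp: fun_eq_iff)
  qed
  then show ?thesis by (simp add: eq_0_iff_value_at)
qed

end

context manifold
begin

lemma
  assumes L: "subbundle n A L"
  shows sections_zero: "0 \<in> sections A L"
    and sections_add: "X \<in> sections A L \<Longrightarrow> Y \<in> sections A L \<Longrightarrow> X + Y \<in> sections A L"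
    and sections_scale: "X \<in> sections A L \<Longrightarrow> f \<in> C \<Longrightarrow> f \<star> X \<in> sections A L"
    and sections_uminus: "X \<in> sections A L \<Longrightarrow> - X \<in> sections A L"
    and sections_diff: "X \<in> sections A L \<Longrightarrow> Y \<in> sections A L \<Longrightarrow> X - Y \<in> sections A L"
proof -
  show "0 \<in> sections A L"
    by (simp add: sections_def value_at_zero subbundle_zero[OF L])
  show add: "X + Y \<in> sections A L" if "X \<in> sections A L" "Y \<in> sections A L" for X Y
    using that by (simp add: sections_def value_at_add subbundle_add[OF L])
  show "f \<star> X \<in> sections A L" if "X \<in> sections A L" "f \<in> C" for X f
    using that by (simp add: sections_def value_at_fscale subbundle_scale[OF L])
  show um: "- X \<in> sections A L" if "X \<in> sections A L" for X
  proof -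
    have "value_at (- X) p = (\<lambda>f. - 1 * value_at X p f)" for p
      by (simp add: value_at_def)
    then show ?thesis
      using that by (simp only: sections_def mem_Collect_eq vf_uminus subbundle_scale[OF L] simp_thms)
  qed
  show "X - Y \<in> sections A L" if "X \<in> sections A L" "Y \<in> sections A L" for X Y
    using add[OF that(1) um[OF that(2)]] by simp
qed

text \<open>The frame fields are already global sections, so the coefficients of \<open>u\<close> at
  \<open>p\<close>, taken as constants, give an extension.\<close>

lemma sections_extend:
  assumes L: "subbundle n A L" and u: "u \<in> L p"
  obtains X where "X \<in> sections A L" "value_at X p = u"
proof -
  obtain E where E: "\<And>i. i < n \<Longrightarrow> E i \<in> sections A L"
    and Lp: "L p = {\<lambda>f. \<Sum>i<n. c i * value_at (E i) p f |c. True}"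
    by (rule subbundle_frame[OF L, of p]) blast
  obtain c where c: "u = (\<lambda>f. \<Sum>i<n. c i * value_at (E i) p f)"
    using u unfolding Lp by blast
  have "m \<le> n \<Longrightarrow> \<exists>X\<in>sections A L. value_at X p = (\<lambda>f. \<Sum>i<m. c i * value_at (E i) p f)" for m
  proof (induction m)
    case 0
    show ?case
      by (rule bexI[OF _ sections_zero[OF L]]) (simp add: value_at_def fun_eq_iff)
  next
    case (Suc m)
    then obtain X where X: "X \<in> sections A L"
        "value_at X p = (\<lambda>f. \<Sum>i<m. c i * value_at (E i) p f)"
      by auto
    have "X + (\<lambda>_. c m) \<star> E m \<in> sections A L"
      using X(1) E[of m] Suc.prems by (intro sections_add[OF L] sections_scale[OF L]) auto
    moreover have "value_at (X + (\<lambda>_. c m) \<star> E m) p = (\<lambda>f. \<Sum>i<Suc m. c i * value_at (E i) p f)"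
      by (simp add: value_at_add value_at_fscale X(2) fun_eq_iff)
    ultimately show ?case by blast
  qed
  with c that show thesis by blast
qed

section \<open>Torsion as a tensor and its relation to d\<eta>\<close>

lemma torsion_tensor11:
  assumes D: "linear_connection A D" and Y: "Y \<in> V"
  shows "tensor11 A (\<lambda>X. torsion D X Y)"
  unfolding tensor11_def
proof (intro conjI ballI)
  note s = linear_connectionD[OF D]
  fix X assume X: "X \<in> V"
  show "torsion D X Y \<in> V" using X Y by (simp add: torsion_def s)
  show "torsion D (X + X') Y = torsion D X Y + torsion D X' Y" if "X' \<in> V" for X'
    using X Y that
    by (simp add: torsion_def s lie_swap[of _ Y] lie_add_right)
  show "torsion D (f \<star> X) Y = f \<star> torsion D X Y" if "f \<in> C" for f
    using X Y that by (simp add: torsion_def s lie_swap[of _ Y] lie_scale_right)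
qed

text \<open>Closedness of d\<eta>, with its derivatives rewritten by parallelism and each bracket as
  \<open>D X Y - D Y X\<close> minus the torsion; only torsion terms survive.\<close>

lemma ext_d_torsion_cyclic:
  assumes \<eta>: "one_form A \<eta>" and D: "linear_connection A D"
    and par: "\<And>X Y Z. X \<in> V \<Longrightarrow> Y \<in> V \<Longrightarrow> Z \<in> V \<Longrightarrow> cov_deriv2 D (ext_d \<eta>) Z X Y = 0"
    and X: "X \<in> V" and Y: "Y \<in> V" and Z: "Z \<in> V"
  shows "ext_d \<eta> (torsion D X Y) Z + ext_d \<eta> (torsion D Y Z) X + ext_d \<eta> (torsion D Z X) Y = 0"
proof -
  note Dv = linear_connection_vf[OF D]
  have P: "Z (ext_d \<eta> X Y) = ext_d \<eta> (D Z X) Y - ext_d \<eta> (D Z Y) X"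
    if "X \<in> V" "Y \<in> V" "Z \<in> V" for X Y Z
    using par[OF that] ext_d_swap[OF \<eta>, of X "D Z Y"] that
    by (simp add: cov_deriv2_def Dv algebra_simps)
  have T: "ext_d \<eta> (lie_bracket X Y) Z =
      ext_d \<eta> (D X Y) Z - ext_d \<eta> (D Y X) Z - ext_d \<eta> (torsion D X Y) Z"
    if v: "X \<in> V" "Y \<in> V" "Z \<in> V" for X Y Z
  proof -
    have l: "lie_bracket X Y = D X Y - D Y X - torsion D X Y"
      by (simp add: torsion_def)
    have t: "torsion D X Y \<in> V" using v by (simp add: torsion_def Dv)
    note s = one_form_simps[OF one_form_ext_d[OF \<eta> v(3)]]
    show ?thesis
      unfolding ext_d_swap[OF \<eta> v(3) vf_lie[OF v(1,2)]] ext_d_swap[OF \<eta> v(3) Dv[OF v(1,2)]]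
        ext_d_swap[OF \<eta> v(3) Dv[OF v(2,1)]] ext_d_swap[OF \<eta> v(3) t]
      by (simp add: l s t v Dv)
  qed
  show ?thesis
    using ext_d_closed[OF \<eta> X Y Z] 
    unfolding P[OF X Y Z] P[OF Y Z X] P[OF Z X Y] T[OF X Y Z] T[OF Y Z X] T[OF Z X Y]
    by (simp add: algebra_simps)
qed

end

section \<open>Bi-Legendrian structures with parallel Pang invariants\<close>

text \<open>Conditions (I), (II) and (III) all say that the signs of the Pang invariants are those
  of \<open>a\<close> and \<open>b\<close>, so dividing by \<open>a\<close> and \<open>b\<close>
  merges them into \<open>pos1\<close> and \<open>pos2\<close>. The assumptions are symmetric under
  exchanging the foliations together with \<open>a\<close> and \<open>b\<close>, which
  \<open>swap\<close> exploits.\<close>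

locale parallel_bi_legendrian = manifold A
  for A :: "('m::{t2_space, second_countable_topology}, 'e::euclidean_space) atlas" +
  fixes n :: nat and \<eta> :: "'m vfield \<Rightarrow> 'm \<Rightarrow> real" and \<xi> :: "'m vfield"
    and L1 L2 :: "'m distribution" and D :: "'m vfield \<Rightarrow> 'm vfield \<Rightarrow> 'm vfield"
    and \<Lambda>1 \<Lambda>2 :: "'m vfield \<Rightarrow> 'm vfield" and a b :: real
  assumes eta_form: "one_form A \<eta>" and xi_reeb: "reeb_field A \<eta> \<xi>"
    and splitting: "bi_legendrian n A \<eta> \<xi> L1 L2"
    and D: "bi_legendrian_connection A \<eta> \<xi> L1 L2 D"
    and par1: "pang_parallel A \<eta> \<xi> D L1" and par2: "pang_parallel A \<eta> \<xi> D L2"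
    and lib1: "libermann_map A \<eta> \<xi> L1 \<Lambda>1" and lib2: "libermann_map A \<eta> \<xi> L2 \<Lambda>2"
    and a0: "a \<noteq> 0" and b0: "b \<noteq> 0"
    and pos1: "X \<in> sections A L1 \<Longrightarrow> value_at X p \<noteq> 0 \<Longrightarrow> pang \<eta> \<xi> X X p / a > 0"
    and pos2: "X \<in> sections A L2 \<Longrightarrow> value_at X p \<noteq> 0 \<Longrightarrow> pang \<eta> \<xi> X X p / b > 0"
    and proportional: "pang_bar_proportional A \<eta> \<xi> L1 L2 \<Lambda>1 \<Lambda>2 (a * b)"
begin

abbreviation S1 where "S1 \<equiv> sections A L1"
abbreviation S2 where "S2 \<equiv> sections A L2"
abbreviation P1 where "P1 \<equiv> proj A \<xi> L1 L2"
abbreviation P2 where "P2 \<equiv> proj A \<xi> L2 L1"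
abbreviation d where "d \<equiv> ext_d \<eta>"
abbreviation PI where "PI \<equiv> pang \<eta> \<xi>"

lemma xi_vf [simp]: "\<xi> \<in> V" and eta_xi [simp]: "\<eta> \<xi> = 1"
  and d_xi_left [simp]: "X \<in> V \<Longrightarrow> d \<xi> X = 0"
  using xi_reeb by (simp_all add: reeb_field_def)

lemma leg1: "legendre_foliation n A \<eta> L1" and leg2: "legendre_foliation n A \<eta> L2"
  using splitting by (simp_all add: bi_legendrian_def)

lemma L1: "subbundle n A L1" and L2: "subbundle n A L2"
  using leg1 leg2 by (simp_all add: legendre_foliation_def)

lemma S1_vf [simp]: "X \<in> S1 \<Longrightarrow> X \<in> V" and S2_vf [simp]: "X \<in> S2 \<Longrightarrow> X \<in> V"
  by (simp_all add: sections_def)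

lemmas S1_simps [simp] = sections_zero[OF L1] sections_add[OF L1] sections_scale[OF L1]
  sections_uminus[OF L1] sections_diff[OF L1]
lemmas S2_simps [simp] = sections_zero[OF L2] sections_add[OF L2] sections_scale[OF L2]
  sections_uminus[OF L2] sections_diff[OF L2]

lemma eta_S1 [simp]: "X \<in> S1 \<Longrightarrow> \<eta> X = 0" and eta_S2 [simp]: "X \<in> S2 \<Longrightarrow> \<eta> X = 0"
  and lie_S1: "X \<in> S1 \<Longrightarrow> Y \<in> S1 \<Longrightarrow> lie_bracket X Y \<in> S1"
  using leg1 leg2 by (simp_all add: legendre_foliation_def)

lemmas eta_simps [simp] = one_form_simps[OF eta_form]
lemmas d_right [simp] = one_form_simps[OF one_form_ext_d[OF eta_form]]

lemma d_left [simp]: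
  assumes "Z \<in> V"
  shows "X \<in> V \<Longrightarrow> Y \<in> V \<Longrightarrow> d (X + Y) Z = d X Z + d Y Z"
    and "X \<in> V \<Longrightarrow> f \<in> C \<Longrightarrow> d (f \<star> X) Z = f * d X Z"
    and "X \<in> V \<Longrightarrow> d (- X) Z = - d X Z"
    and "X \<in> V \<Longrightarrow> Y \<in> V \<Longrightarrow> d (X - Y) Z = d X Z - d Y Z"
    and "d 0 Z = 0"
  using assms by (simp_all add: ext_d_swap[OF eta_form assms])

lemma d_xi_right [simp]: "X \<in> V \<Longrightarrow> d X \<xi> = 0"
  using ext_d_swap[OF eta_form, of \<xi> X] by simp

lemma d_S1 [simp]: "X \<in> S1 \<Longrightarrow> Y \<in> S1 \<Longrightarrow> d X Y = 0"
  by (simp add: ext_d_altdef lie_S1 vf_0[OF S1_vf])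

lemma D_connection: "linear_connection A D"
  using D by (simp add: bi_legendrian_connection_def)

lemmas D_simps [simp] = linear_connectionD[OF D_connection]

lemma D_S1 [simp]: "X \<in> V \<Longrightarrow> Y \<in> S1 \<Longrightarrow> D X Y \<in> S1"
  and D_S2 [simp]: "X \<in> V \<Longrightarrow> Y \<in> S2 \<Longrightarrow> D X Y \<in> S2"
  and D_xi [simp]: "X \<in> V \<Longrightarrow> D X \<xi> = 0"
  and D_d: "X \<in> V \<Longrightarrow> Y \<in> V \<Longrightarrow> Z \<in> V \<Longrightarrow> cov_deriv2 D d Z X Y = 0"
  and torsion_12: "X \<in> S1 \<Longrightarrow> Y \<in> S2 \<Longrightarrow> torsion D X Y = ((\<lambda>_. 2) * d X Y) \<star> \<xi>"
  and torsion_xi: "X \<in> V \<Longrightarrow>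
    torsion D X \<xi> = P2 (lie_bracket \<xi> (P1 X)) + P1 (lie_bracket \<xi> (P2 X))"
  using D by (simp_all add: bi_legendrian_connection_def times_fun_def)

section \<open>The splitting and its projections\<close>

lemma splitting_unique:
  assumes "Y \<in> S1" "Z \<in> S2" "f \<in> C" "Y' \<in> S1" "Z' \<in> S2" "f' \<in> C"
    and "Y + Z + f \<star> \<xi> = Y' + Z' + f' \<star> \<xi>"
  shows "Y = Y'" and "Z = Z'"
proof -
  have *: "value_at (Y - Y') p = 0 \<and> value_at (Z - Z') p = 0" for p
  proof -
    have "Y - Y' + (Z - Z') + (f - f') \<star> \<xi> = 0"
      using assms(7) by (simp add: fun_eq_iff fscale_apply algebra_simps)
    then have "value_at (Y - Y' + (Z - Z') + (f - f') \<star> \<xi>) p = 0"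
      by (simp only: value_at_zero)
    then have "value_at (Y - Y') p + value_at (Z - Z') p
        + (\<lambda>u. (f p - f' p) * value_at \<xi> p u) = 0"
      by (simp only: value_at_add value_at_fscale minus_apply)
    moreover have "value_at (Y - Y') p \<in> L1 p" "value_at (Z - Z') p \<in> L2 p"
      by (rule sections_value, rule sections_diff[OF L1 assms(1,4)])
        (rule sections_value, rule sections_diff[OF L2 assms(2,5)])
    ultimately show ?thesis
      using splitting unfolding bi_legendrian_def by blast
  qed
  from * have "Y - Y' = 0" and "Z - Z' = 0" by (simp_all only: eq_0_iff_value_at simp_thms)
  then show "Y = Y'" and "Z = Z'" by simp_all
qed

lemma proj_eq:
  assumes "Y \<in> S1" "Z \<in> S2" "f \<in> C"
  shows "P1 (Y + Z + f \<star> \<xi>) = Y" and "P2 (Y + Z + f \<star> \<xi>) = Z"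
proof -
  show "P1 (Y + Z + f \<star> \<xi>) = Y"
    unfolding proj_def using assms splitting_unique by (intro the_equality) blast+
  show "P2 (Y + Z + f \<star> \<xi>) = Z"
    unfolding proj_def
  proof (rule the_equality)
    show "Z \<in> S2 \<and> (\<exists>Za\<in>S1. \<exists>fa\<in>C. Y + Z + f \<star> \<xi> = Z + Za + fa \<star> \<xi>)"
      using assms by (metis add.commute)
    show "Z' = Z" if "Z' \<in> S2 \<and> (\<exists>Za\<in>S1. \<exists>fa\<in>C. Y + Z + f \<star> \<xi> = Z' + Za + fa \<star> \<xi>)" for Z'
      using that assms splitting_unique(2) by (metis add.commute)
  qed
qed

lemma
  assumes "X \<in> V"
  shows P1_S1 [simp]: "P1 X \<in> S1" and P2_S2 [simp]: "P2 X \<in> S2"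
    and decompose: "X = P1 X + P2 X + \<eta> X \<star> \<xi>"
proof -
  obtain Y Z f where X: "Y \<in> S1" "Z \<in> S2" "f \<in> C" "X = Y + Z + f \<star> \<xi>"
    using splitting assms unfolding bi_legendrian_def by blast
  \<comment> \<open>Both foliations lie in the kernel of \<eta>, so \<eta> reads off the coefficient
    of \<xi>.\<close>
  have "\<eta> X = f" using X(1-3) unfolding X(4) by simp
  then show "P1 X \<in> S1" "P2 X \<in> S2" "X = P1 X + P2 X + \<eta> X \<star> \<xi>"
    using X proj_eq[OF X(1-3)] by metis+
qed

lemma proj_S1 [simp]: "X \<in> S1 \<Longrightarrow> P1 X = X" "X \<in> S1 \<Longrightarrow> P2 X = 0"
  using proj_eq[of X 0 0] by simp_all

lemma proj_S2 [simp]: "X \<in> S2 \<Longrightarrow> P1 X = 0" "X \<in> S2 \<Longrightarrow> P2 X = X"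
  using proj_eq[of 0 X 0] by simp_all

lemma proj_xi [simp]: "P1 \<xi> = 0" "P2 \<xi> = 0"
  using proj_eq[of 0 0 1] by (simp_all add: fscale_def)

lemma P1_tensor11: "tensor11 A P1"
  unfolding tensor11_def
proof (intro conjI ballI)
  fix X assume X: "X \<in> V"
  then show "P1 X \<in> V" by simp
  show "P1 (X + Y) = P1 X + P1 Y" if Y: "Y \<in> V" for Y
  proof -
    have "X + Y = (P1 X + P1 Y) + (P2 X + P2 Y) + (\<eta> X + \<eta> Y) \<star> \<xi>"
      by (subst decompose[OF X], subst decompose[OF Y]) (simp only: fscale_add_left add_ac)
    then show ?thesis
      using X Y by (simp only: proj_eq S1_simps S2_simps P1_S1 P2_S2 smooth_fun_add eta_simps)
  qed
  show "P1 (f \<star> X) = f \<star> P1 X" if f: "f \<in> C" for f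
  proof -
    have "f \<star> X = f \<star> P1 X + f \<star> P2 X + (f * \<eta> X) \<star> \<xi>"
      by (subst decompose[OF X]) (simp only: fscale_add_right fscale_assoc)
    then show ?thesis
      using X f by (simp only: proj_eq S1_simps S2_simps P1_S1 P2_S2 smooth_fun_mult eta_simps)
  qed
qed

text \<open>\<open>D\<close> preserves both foliations and kills \<xi>, so differentiating the
  decomposition of \<open>X\<close> gives that of \<open>D Z X\<close>.\<close>

lemma D_P1:
  assumes X: "X \<in> V" and Z: "Z \<in> V"
  shows "D Z (P1 X) = P1 (D Z X)"
proof -
  have "D Z X = D Z (P1 X) + D Z (P2 X) + Z (\<eta> X) \<star> \<xi>"
    by (subst decompose[OF X]) (simp add: X Z vf_smooth[OF Z])
  then show ?thesis
    using X Z by (simp add: proj_eq vf_smooth[OF Z])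
qed

section \<open>The Pang invariant as a definite symmetric form\<close>

lemma Pi_altdef: "PI X Y = (\<lambda>_. 2) * d (lie_bracket \<xi> X) Y"
  by (simp add: pang_def fun_eq_iff)

lemma Pi_right [simp]:
  assumes "X \<in> V"
  shows "Y \<in> V \<Longrightarrow> Z \<in> V \<Longrightarrow> PI X (Y + Z) = PI X Y + PI X Z"
    and "Y \<in> V \<Longrightarrow> f \<in> C \<Longrightarrow> PI X (f \<star> Y) = f * PI X Y"
    and "Y \<in> V \<Longrightarrow> PI X (- Y) = - PI X Y"
    and "Y \<in> V \<Longrightarrow> Z \<in> V \<Longrightarrow> PI X (Y - Z) = PI X Y - PI X Z"
    and "PI X 0 = 0"
  using assms by (simp_all add: Pi_altdef algebra_simps)

lemma eta_lie_xi [simp]: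
  assumes X: "X \<in> S1"
  shows "\<eta> (lie_bracket \<xi> X) = 0"
proof -
  have "d \<xi> X = 0" using X by simp
  then show ?thesis
    using X unfolding ext_d_altdef by (simp add: vf_0 vf_1[OF S1_vf[OF X]] fun_eq_iff)
qed

lemma Pi_eq_eta:
  assumes X: "X \<in> S1" and Y: "Y \<in> S1"
  shows "PI X Y = - \<eta> (lie_bracket (lie_bracket \<xi> X) Y)"
  using X Y
  by (simp add: Pi_altdef ext_d_altdef vf_0[OF S1_vf[OF Y]] vf_0[OF vf_lie[OF xi_vf S1_vf[OF X]]])
    (simp add: fun_eq_iff)

text \<open>By the Jacobi identity the two sides differ by
  \<open>\<eta> (lie_bracket \<xi> (lie_bracket X Y))\<close>, which vanishes because the foliation
  is involutive.\<close>

lemma Pi_sym: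
  assumes X: "X \<in> S1" and Y: "Y \<in> S1"
  shows "PI X Y = PI Y X"
proof -
  have "lie_bracket (lie_bracket \<xi> X) Y =
      - lie_bracket (lie_bracket X Y) \<xi> - lie_bracket (lie_bracket Y \<xi>) X"
    using X Y by (intro jacobi) auto
  moreover have "lie_bracket (lie_bracket X Y) \<xi> = - lie_bracket \<xi> (lie_bracket X Y)"
    by (rule lie_swap)
  moreover have "lie_bracket (lie_bracket Y \<xi>) X = - lie_bracket (lie_bracket \<xi> Y) X"
    \<comment> \<open>Pulling a sign out of a derivation is justified on smooth functions, hence the
      test on \<open>C\<close>.\<close>
    by (rule vf_eqI) (use X Y in simp_all, use X Y in \<open>simp add: lie_bracket_def vf_simps[OF
      S1_vf[OF X]] vf_simps[OF S1_vf[OF Y]]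
          vf_simps[OF xi_vf]\<close>)
  ultimately have "lie_bracket (lie_bracket \<xi> X) Y =
      lie_bracket \<xi> (lie_bracket X Y) + lie_bracket (lie_bracket \<xi> Y) X"
    by simp
  then show ?thesis
    using X Y by (simp add: Pi_eq_eta lie_S1)
qed

text \<open>Goes through symmetry, because \<open>lie_bracket \<xi> X\<close> is not linear over
  \<open>C\<close> in \<open>X\<close>.\<close>

lemma Pi_left:
  assumes "Z \<in> S1"
  shows "X \<in> S1 \<Longrightarrow> Y \<in> S1 \<Longrightarrow> PI (X + Y) Z = PI X Z + PI Y Z"
    and "X \<in> S1 \<Longrightarrow> f \<in> C \<Longrightarrow> PI (f \<star> X) Z = f * PI X Z"
  using assms by (simp_all add: Pi_sym[of _ Z])

lemma Pi_nondegenerate: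
  assumes X: "X \<in> S1" and "\<And>Z. Z \<in> S1 \<Longrightarrow> PI X Z = 0"
  shows "X = 0"
proof (rule ccontr)
  assume "X \<noteq> 0"
  then obtain p where "value_at X p \<noteq> 0" by (auto simp: eq_0_iff_value_at)
  from pos1[OF X this] assms show False by simp
qed

text \<open>Where \<open>X\<close> vanishes, nonnegativity follows by positivity of \<open>Y + t X\<close> for all real \<open>t\<close>,
  which avoids proving that tensors are local.\<close>

lemma Pi_nonneg:
  assumes X: "X \<in> S1"
  shows "0 \<le> PI X X p / a"
proof (cases "n = 0")
  case True
  then have "X = 0" using sections_rank_0[OF L1] X by blast
  then show ?thesis by simp
next
  case False
  then obtain Y where Y: "Y \<in> S1" "value_at Y p \<noteq> 0"
    using sections_nonvanishing[OF L1, of p] by blast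
  show ?thesis
  proof (cases "value_at X p = 0")
    case True
    have *: "0 < PI Y Y p / a + t * (2 * (PI Y X p / a)) + t\<^sup>2 * (PI X X p / a)" for t
    proof -
      have "Y + (\<lambda>_. t) \<star> X \<in> S1" using X Y by simp
      moreover have "value_at (Y + (\<lambda>_. t) \<star> X) p \<noteq> 0"
        using Y True by (simp add: value_at_add value_at_fscale fun_eq_iff)
      ultimately have "0 < PI (Y + (\<lambda>_. t) \<star> X) (Y + (\<lambda>_. t) \<star> X) p / a" by (rule pos1)
      also have "\<dots> = PI Y Y p / a + t * (2 * (PI Y X p / a)) + t\<^sup>2 * (PI X X p / a)"
        using X Y by (simp add: Pi_left Pi_sym[OF X Y(1)] add_divide_distrib power2_eq_square algebra_simps)
      finally show ?thesis .
    qed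
    define u v w where "u = PI Y Y p / a" and "v = PI Y X p / a" and "w = PI X X p / a"
    have *: "0 < u + t * (2 * v) + t\<^sup>2 * w" for t
      using *[of t] unfolding u_def v_def w_def .
    have "0 \<le> w"
    proof (rule ccontr)
      assume "\<not> 0 \<le> w"
      then have w: "w < 0" by simp
      \<comment> \<open>Chosen so that \<open>u + s\<^sup>2 * w = 0\<close>; positivity at both
        \<open>s\<close> and \<open>- s\<close> then makes the linear term positive with either
        sign.\<close>
      define s where "s = sqrt (u / (- w))"
      have u: "u > 0" using *[of 0] by simp
      have "0 \<le> u / (- w)" using u w by (intro divide_nonneg_pos) simp_all
      then have "s\<^sup>2 = u / (- w)" unfolding s_def by (rule real_sqrt_pow2)
      then have "s\<^sup>2 * w = - u" using w by simp
      with *[of s] *[of "- s"] show False by simp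
    qed
    then show ?thesis by (simp add: w_def)
  next
    case False
    then show ?thesis using pos1[OF X] less_imp_le by blast
  qed
qed

section \<open>Libermann maps\<close>

lemma lam1 [simp]: "X \<in> V \<Longrightarrow> \<Lambda>1 X \<in> S1" and lam2 [simp]: "X \<in> V \<Longrightarrow> \<Lambda>2 X \<in> S2"
  and Pi_lam1: "X \<in> V \<Longrightarrow> Y \<in> S1 \<Longrightarrow> PI (\<Lambda>1 X) Y = d X Y"
  and Pi_lam2: "X \<in> V \<Longrightarrow> Y \<in> S2 \<Longrightarrow> PI (\<Lambda>2 X) Y = d X Y"
  using lib1 lib2 by (simp_all add: libermann_map_def)

text \<open>Nondegeneracy of the Pang invariant; identities for \<Lambda>1 below are proved by
  testing against sections of \<open>L1\<close>.\<close>

lemma lam1_unique: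
  assumes X: "X \<in> V" and W: "W \<in> S1" and "\<And>Y. Y \<in> S1 \<Longrightarrow> PI W Y = d X Y"
  shows "\<Lambda>1 X = W"
proof -
  have "PI (\<Lambda>1 X - W) Z = 0" if "Z \<in> S1" for Z
  proof -
    have "PI (\<Lambda>1 X - W) Z = PI Z (\<Lambda>1 X) - PI Z W"
      using X W that Pi_sym[of "\<Lambda>1 X - W" Z] by simp
    also have "\<dots> = PI (\<Lambda>1 X) Z - PI W Z"
      using X W that Pi_sym[of Z] by simp
    finally show ?thesis
      using assms(3)[OF that] Pi_lam1[OF X that] by simp
  qed
  then have "\<Lambda>1 X - W = 0" using X W by (intro Pi_nondegenerate) auto
  then show ?thesis by simp
qed

lemma lam1_tensor11: "tensor11 A \<Lambda>1"
  unfolding tensor11_def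
  by (auto intro!: lam1_unique simp: Pi_left Pi_lam1)

lemmas lam1_simps [simp] = tensor11_simps[OF lam1_tensor11]

lemma lam1_S1 [simp]: "X \<in> S1 \<Longrightarrow> \<Lambda>1 X = 0"
  by (rule lam1_unique) (simp_all add: Pi_sym[of 0])

lemma lam1_xi [simp]: "\<Lambda>1 \<xi> = 0"
  by (rule lam1_unique) (simp_all add: Pi_sym[of 0])

lemma lam1_P2: "X \<in> V \<Longrightarrow> \<Lambda>1 (P2 X) = \<Lambda>1 X"
proof -
  assume X: "X \<in> V"
  have "\<Lambda>1 X = \<Lambda>1 (P1 X + P2 X + \<eta> X \<star> \<xi>)" using decompose[OF X] by simp
  also have "\<dots> = \<Lambda>1 (P2 X)" using X by simp
  finally show ?thesis by simp
qed

lemma Pi_S1_prop: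
  assumes X: "X \<in> S1"  and Y: "Y \<in> S1"
  shows "PI X Y = (\<lambda>_. a * b) * PI (\<Lambda>2 X) (\<Lambda>2 Y)"
proof -
  have z: "W = 0" if "W \<in> S1" "W \<in> S2" for W
    using that proj_S1(1) proj_S2(1) by metis
  \<comment> \<open>Sections of both foliations are zero, so the two branches of
    \<open>pang_bar\<close> agree in this degenerate case.\<close>
  have "PI (\<Lambda>2 X) (\<Lambda>2 Y) = PI X Y" if "X \<in> S2" "Y \<in> S2"
    using z[OF X that(1)] z[OF Y that(2)] Pi_lam2[of 0 "\<Lambda>2 0"] by simp
  then have "pang_bar A \<eta> \<xi> L2 \<Lambda>2 X Y = PI (\<Lambda>2 X) (\<Lambda>2 Y)"
    unfolding pang_bar_def by auto
  moreover have "pang_bar A \<eta> \<xi> L1 \<Lambda>1 X Y = PI X Y"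
    unfolding pang_bar_def using X Y by simp
  ultimately show ?thesis
    using proportional X Y unfolding pang_bar_proportional_def by (simp add: times_fun_def)
qed

text \<open>Tested against \<open>Z\<close>, proportionality gives
  \<open>PI X Z = a b d(Z, \<Lambda>2 X)\<close>, and by definition of \<Lambda>1 the right side is
  \<open>- a b PI (\<Lambda>1 (\<Lambda>2 X)) Z\<close>. This is the source of
  \<open>\<phi>\<^sup>2 = - I\<close> on the foliation.\<close>

lemma lam1_lam2:
  assumes X: "X \<in> S1"
  shows "(\<lambda>_. a * b) \<star> \<Lambda>1 (\<Lambda>2 X) = - X"
proof -
  have "PI (X + (\<lambda>_. a * b) \<star> \<Lambda>1 (\<Lambda>2 X)) Z = 0" if Z: "Z \<in> S1" for Z
  proof -
    have "PI X Z = (\<lambda>_. a * b) * d Z (\<Lambda>2 X)"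
      using X Z Pi_S1_prop[OF Z X] by (simp add: Pi_sym[OF X Z] Pi_lam2)
    then show ?thesis
      using X Z by (simp add: Pi_left Pi_lam1 ext_d_swap[OF eta_form, of Z "\<Lambda>2 X"])
  qed
  then have "X + (\<lambda>_. a * b) \<star> \<Lambda>1 (\<Lambda>2 X) = 0"
    using X by (intro Pi_nondegenerate) auto
  then show ?thesis by (simp add: eq_neg_iff_add_eq_0 add.commute)
qed

text \<open>Both forms in the defining equation \<open>Pi_lam1\<close> are
  \<open>D\<close>-parallel, so differentiating it shows that \<open>D Z (\<Lambda>1 X)\<close>
  satisfies the equation for \<open>D Z X\<close>.\<close>

lemma D_lam1:
  assumes X: "X \<in> V" and Z: "Z \<in> V"
  shows "D Z (\<Lambda>1 X) = \<Lambda>1 (D Z X)"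
proof (rule lam1_unique[symmetric])
  fix Y assume Y: "Y \<in> S1"
  have "cov_deriv2 D PI Z (\<Lambda>1 X) Y = 0"
    using par1 X Y Z by (simp add: pang_parallel_def)
  then have "Z (PI (\<Lambda>1 X) Y) = PI (D Z (\<Lambda>1 X)) Y + PI (\<Lambda>1 X) (D Z Y)"
    unfolding cov_deriv2_def by (simp add: algebra_simps)
  moreover have "Z (d X Y) = d (D Z X) Y + d X (D Z Y)"
    using D_d[OF X S1_vf[OF Y] Z] unfolding cov_deriv2_def by (simp add: algebra_simps)
  ultimately show "PI (D Z (\<Lambda>1 X)) Y = d (D Z X) Y"
    using X Y Z by (simp add: Pi_lam1)
qed (use X Z in simp_all)

lemma lam1_lie_xi:
  assumes X: "X \<in> S1"
  shows "\<Lambda>1 (lie_bracket \<xi> X) = (\<lambda>_. 1/2) \<star> X"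
proof (rule lam1_unique)
  show "PI ((\<lambda>_. 1/2) \<star> X) Y = d (lie_bracket \<xi> X) Y" if Y: "Y \<in> S1" for Y
    using Pi_left(2)[OF Y X, of "\<lambda>_. 1/2"] by (simp add: Pi_altdef[of X] fun_eq_iff)
qed (use X in simp_all)

text \<open>Both \<open>d X (\<Lambda>1 Y)\<close> and \<open>d Y (\<Lambda>1 X)\<close> are values
  of the symmetric form \<open>PI\<close> on \<open>\<Lambda>1 X\<close> and
  \<open>\<Lambda>1 Y\<close>. The symmetry of \<open>g\<close> rests on this.\<close>

lemma d_lam1:
  assumes X: "X \<in> V" and Y: "Y \<in> V"
  shows "d (\<Lambda>1 X) Y = - d X (\<Lambda>1 Y)"
  using Pi_lam1[OF X, of "\<Lambda>1 Y"] Pi_lam1[OF Y, of "\<Lambda>1 X"] Pi_sym[of "\<Lambda>1 X" "\<Lambda>1 Y"]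
    ext_d_swap[OF eta_form Y, of "\<Lambda>1 X"] X Y
  by simp

text \<open>In the cyclic identity with \<open>Z\<close> in \<open>L2\<close> the mixed torsions are
  multiples of \<xi>, which d\<eta> kills; so d\<eta> pairs the torsion trivially with
  \<open>L2\<close>. Proportionality expresses its Pang pairings through \<open>\<Lambda>2 Z\<close>
  in \<open>L2\<close>, and nondegeneracy concludes.\<close>

lemma torsion_S1:
  assumes X: "X \<in> S1" and Y: "Y \<in> S1"
  shows "torsion D X Y = 0"
proof (rule Pi_nondegenerate)
  show T: "torsion D X Y \<in> S1" using X Y by (simp add: torsion_def lie_S1)
  have d0: "d (torsion D X Y) Z = 0" if Z: "Z \<in> S2" for Z
  proof -
    have "d (torsion D Y Z) X = 0" and "d (torsion D Z X) Y = 0"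
      using X Y Z unfolding torsion_swap[of D Z X] torsion_12[OF X Z] torsion_12[OF Y Z] by simp_all
    then show ?thesis
      using ext_d_torsion_cyclic[OF eta_form D_connection D_d S1_vf[OF X] S1_vf[OF Y] S2_vf[OF Z]]
      by simp
  qed
  show "PI (torsion D X Y) Z = 0" if Z: "Z \<in> S1" for Z
    using T Z Pi_S1_prop[OF T Z] by (simp add: Pi_lam2 d0)
qed

text \<open>Yields the \<open>L2\<close> version of every fact proved for \<open>L1\<close>. For the
  mixed torsion, the signs from antisymmetry of torsion and of d\<eta> cancel.\<close>

lemma swap: "parallel_bi_legendrian A n \<eta> \<xi> L2 L1 D \<Lambda>2 \<Lambda>1 b a"
proof unfold_locales
  show "bi_legendrian n A \<eta> \<xi> L2 L1"
    unfolding bi_legendrian_def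
  proof (intro conjI allI ballI impI)
    fix p u v c
    assume u: "u \<in> L2 p" and v: "v \<in> L1 p" and "u + v + (\<lambda>f. c * value_at \<xi> p f) = 0"
    then have "v + u + (\<lambda>f. c * value_at \<xi> p f) = 0" by (simp only: add.commute[of u v])
    with u v show "u = 0" and "v = 0" and "c = 0"
      using splitting unfolding bi_legendrian_def by blast+
  next
    fix X assume X: "X \<in> V"
    have "X = P2 X + P1 X + \<eta> X \<star> \<xi>"
      by (subst add.commute[of "P2 X"]) (rule decompose[OF X])
    then show "\<exists>Y\<in>S2. \<exists>Z\<in>S1. \<exists>f\<in>C. X = Y + Z + f \<star> \<xi>"
      using P2_S2[OF X] P1_S1[OF X] eta_simps(1)[OF X] by blast
  qed (rule leg1 leg2)+
  show "bi_legendrian_connection A \<eta> \<xi> L2 L1 D"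
    unfolding bi_legendrian_connection_def
  proof (intro conjI ballI)
    fix X Y assume X: "X \<in> S2" and Y: "Y \<in> S1"
    have "torsion D X Y = - (((\<lambda>_. 2) * d Y X) \<star> \<xi>)"
      unfolding torsion_swap[of D X Y] torsion_12[OF Y X] ..
    also have "\<dots> = (\<lambda>p. 2 * d X Y p) \<star> \<xi>"
      using ext_d_swap[OF eta_form, of X Y] X Y by (simp add: fun_eq_iff fscale_apply)
    finally show "torsion D X Y = (\<lambda>p. 2 * d X Y p) \<star> \<xi>" .
  next
    fix X assume "X \<in> V"
    then show "torsion D X \<xi> = P1 (lie_bracket \<xi> (P2 X)) + P2 (lie_bracket \<xi> (P1 X))"
      by (simp only: torsion_xi add.commute)
  qed (simp_all add: D_connection D_d)
  show "pang_bar_proportional A \<eta> \<xi> L2 L1 \<Lambda>2 \<Lambda>1 (b * a)"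
    using proportional unfolding pang_bar_proportional_def by (simp add: mult.commute)
qed (rule eta_form xi_reeb par1 par2 lib1 lib2 a0 b0 pos1 pos2; assumption?)+

section \<open>The contact metric structure\<close>

definition \<phi> :: "'m vfield \<Rightarrow> 'm vfield" where
  "\<phi> X = - ((\<lambda>_. a) \<star> \<Lambda>1 X + (\<lambda>_. b) \<star> \<Lambda>2 X)"

text \<open>The torsion with \<xi> is \<open>(a / 2) \<phi>\<close> on \<open>L1\<close> and
  \<open>(b / 2) \<phi>\<close> on \<open>L2\<close>; the mean of the factors is
  \<open>k = (a + b) / 4\<close>, and \<open>(a - b) / 4\<close> is the deviation from it.\<close>

definition h :: "'m vfield \<Rightarrow> 'm vfield" where
  "h X = (\<lambda>_. (a - b) / 4) \<star> (P1 X - P2 X)"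

definition g :: "'m vfield \<Rightarrow> 'm vfield \<Rightarrow> 'm \<Rightarrow> real" where
  "g X Y = \<eta> X * \<eta> Y - d X (\<phi> Y)"

end

context parallel_bi_legendrian
begin

interpretation swap: parallel_bi_legendrian A n \<eta> \<xi> L2 L1 D \<Lambda>2 \<Lambda>1 b a
  by (rule swap)

lemma phi_tensor11: "tensor11 A \<phi>"
  unfolding tensor11_def \<phi>_def by (simp add: fscale_assoc mult.commute)

lemmas phi_simps [simp] = tensor11_simps[OF phi_tensor11]

lemmas P_simps [simp] = tensor11_simps[OF P1_tensor11] tensor11_simps[OF swap.P1_tensor11]

lemma phi_phi:
  assumes X: "X \<in> V"
  shows "\<phi> (\<phi> X) = - X + \<eta> X \<star> \<xi>"
proof -
  \<comment> \<open>The squares of the Libermann maps drop out, as each map kills its own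
    foliation.\<close>
  have "\<phi> (\<phi> X) = (\<lambda>_. a * b) \<star> \<Lambda>1 (\<Lambda>2 X) + (\<lambda>_. b * a) \<star> \<Lambda>2 (\<Lambda>1 X)"
    using X by (simp add: \<phi>_def fscale_assoc times_fun_def)
  also have "\<dots> = - P1 X - P2 X"
    using lam1_lam2[OF P1_S1[OF X]] swap.lam1_lam2[OF P2_S2[OF X]]
    by (simp add: lam1_P2[OF X] swap.lam1_P2[OF X])
  also have "\<dots> = - X + \<eta> X \<star> \<xi>"
    using decompose[OF X] by (simp add: algebra_simps)
  finally show ?thesis .
qed

lemma eta_phi [simp]: "X \<in> V \<Longrightarrow> \<eta> (\<phi> X) = 0"
  by (simp add: \<phi>_def)

lemma phi_xi [simp]: "\<phi> \<xi> = 0"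
  by (simp add: \<phi>_def)

lemma d_phi: "X \<in> V \<Longrightarrow> Y \<in> V \<Longrightarrow> d (\<phi> X) Y = - d X (\<phi> Y)"
  by (simp add: \<phi>_def d_lam1 swap.d_lam1)

text \<open>Directly, \<open>g X X\<close> is \<eta>(X) squared plus
  \<open>a d(X, \<Lambda>1 X) + b d(X, \<Lambda>2 X)\<close>. Proportionality turns the first
  summand into the Pang invariant on \<open>L2\<close> over \<open>b\<close>, the second into that
  on \<open>L1\<close> over \<open>a\<close>.\<close>

lemma g_self:
  assumes X: "X \<in> V"
  shows "g X X p = (\<eta> X p)\<^sup>2 + PI (P1 X) (P1 X) p / a + PI (P2 X) (P2 X) p / b"
proof -
  have 1: "PI (P1 X) (P1 X) p = a * b * d X (\<Lambda>2 X) p"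
    using Pi_S1_prop[of "P1 X" "P1 X"] X by (simp add: swap.lam1_P2 Pi_lam2)
  have 2: "PI (P2 X) (P2 X) p = a * b * d X (\<Lambda>1 X) p"
    using swap.Pi_S1_prop[of "P2 X" "P2 X"] X by (simp add: lam1_P2 Pi_lam1)
  show ?thesis
    using X a0 b0 unfolding 1 2 by (simp add: g_def \<phi>_def power2_eq_square)
qed

lemma g_metric: "riemannian_metric A g"
  unfolding riemannian_metric_def
proof (intro conjI ballI allI impI)
  fix X assume X: "X \<in> V"
  show "one_form A (g X)"
    unfolding one_form_def g_def using X by (simp add: algebra_simps)
  show "g X Y = g Y X" if Y: "Y \<in> V" for Y
    using d_phi[OF X Y] ext_d_swap[OF eta_form Y, of "\<phi> X"] X Y by (simp add: g_def mult.commute)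
  show "g X X p > 0" if nz: "value_at X p \<noteq> 0" for p
  proof -
    \<comment> \<open>Definiteness says nothing where a projection vanishes at \<open>p\<close>,
      hence \<open>Pi_nonneg\<close>.\<close>
    have nonneg: "0 \<le> PI (P1 X) (P1 X) p / a" "0 \<le> PI (P2 X) (P2 X) p / b"
      using X Pi_nonneg swap.Pi_nonneg by simp_all
    have eq: "value_at X p = value_at (P1 X) p + value_at (P2 X) p + (\<lambda>u. \<eta> X p * value_at \<xi> p u)"
      by (subst decompose[OF X]) (simp only: value_at_add value_at_fscale)
    have "value_at X p = 0" if "value_at (P1 X) p = 0" "value_at (P2 X) p = 0" "\<eta> X p = 0"
      unfolding eq using that by (simp add: fun_eq_iff)
    with nz consider "value_at (P1 X) p \<noteq> 0" | "value_at (P2 X) p \<noteq> 0" | "\<eta> X p \<noteq> 0"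
      by blast
    then show ?thesis
    proof cases
      case 1
      then have "0 < PI (P1 X) (P1 X) p / a" using X pos1 by simp
      then show ?thesis using nonneg unfolding g_self[OF X] by (simp add: add_nonneg_pos add_pos_nonneg)
    next
      case 2
      then have "0 < PI (P2 X) (P2 X) p / b" using X pos2 by simp
      then show ?thesis using nonneg unfolding g_self[OF X] by (simp add: add_nonneg_pos)
    next
      case 3
      then have "0 < (\<eta> X p)\<^sup>2" by simp
      then show ?thesis using nonneg unfolding g_self[OF X] by linarith
    qed
  qed
qed

lemma contact_metric: "contact_metric_structure A \<phi> \<xi> \<eta> g"
  unfolding contact_metric_structure_def
  using eta_form xi_reeb phi_tensor11 g_metric
  by (simp add: phi_phi g_def d_phi)

section \<open>The tensor \<open>h\<close> and the torsion of the bi-Legendrian connection\<close>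

lemma h_tensor11: "tensor11 A h"
  unfolding tensor11_def h_def by (simp add: fscale_assoc mult.commute)

lemmas h_simps [simp] = tensor11_simps[OF h_tensor11]

text \<open>\<phi> exchanges the two foliations, on which \<open>h\<close> acts by opposite
  scalars.\<close>

lemma h_phi:
  assumes X: "X \<in> V"
  shows "h (\<phi> X) = - \<phi> (h X)"
  using X by (simp add: h_def \<phi>_def lam1_P2 swap.lam1_P2) (simp add: fun_eq_iff fscale_apply algebra_simps)

lemma h_h:
  assumes X: "X \<in> V"
  shows "h (h X) = (\<lambda>_. ((a - b) / 4)\<^sup>2) \<star> (X - \<eta> X \<star> \<xi>)"
proof -
  have "X - \<eta> X \<star> \<xi> = P1 X + P2 X"
    using decompose[OF X] by (simp add: algebra_simps)
  then show ?thesis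
    using X by (simp only:) (simp add: h_def, simp add: fun_eq_iff fscale_apply power2_eq_square)
qed

lemma d_decompose:
  assumes "X \<in> V" "Y \<in> V"
  shows "d X Y = d (P1 X) (P2 Y) + d (P2 X) (P1 Y)"
proof -
  have "d X Y = d (P1 X + P2 X + \<eta> X \<star> \<xi>) (P1 Y + P2 Y + \<eta> Y \<star> \<xi>)"
    using decompose[OF assms(1)] decompose[OF assms(2)] by simp
  also have "\<dots> = d (P1 X) (P2 Y) + d (P2 X) (P1 Y)"
    using assms by (simp add: algebra_simps)
  finally show ?thesis .
qed

text \<open>d\<eta> pairs only \<open>L1\<close> with \<open>L2\<close>, where \<open>h\<close> acts
  by opposite scalars.\<close>

lemma d_h:
  assumes X: "X \<in> V" and Y: "Y \<in> V"
  shows "d (h X) Y = - d X (h Y)"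
  using X Y by (simp add: h_def d_decompose[of _ Y] d_decompose[of X] algebra_simps)

lemma torsion_xi_phi:
  assumes X: "X \<in> V"
  shows "torsion D X \<xi> = (\<lambda>_. (a + b) / 4) \<star> \<phi> X + \<phi> (h X)"
proof -
  \<comment> \<open>By \<open>lam1_lie_xi\<close>, \<phi> sends the left side to
    \<open>- (a / 2) Y\<close>; a second \<phi> inverts this.\<close>
  have 1: "P2 (lie_bracket \<xi> Y) = (\<lambda>_. a / 2) \<star> \<phi> Y" if Y: "Y \<in> S1" for Y
  proof -
    have W: "P2 (lie_bracket \<xi> Y) \<in> S2" using Y by simp
    have "\<phi> (P2 (lie_bracket \<xi> Y)) = - ((\<lambda>_. a / 2) \<star> Y)"
      using Y W by (simp add: \<phi>_def lam1_P2 lam1_lie_xi fscale_assoc times_fun_def)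
    then have "\<phi> (\<phi> (P2 (lie_bracket \<xi> Y))) = - ((\<lambda>_. a / 2) \<star> \<phi> Y)" using Y by simp
    then show ?thesis using W by (simp add: phi_phi)
  qed
  have 2: "P1 (lie_bracket \<xi> Y) = (\<lambda>_. b / 2) \<star> \<phi> Y" if Y: "Y \<in> S2" for Y
  proof -
    have W: "P1 (lie_bracket \<xi> Y) \<in> S1" using Y by simp
    have "\<phi> (P1 (lie_bracket \<xi> Y)) = - ((\<lambda>_. b / 2) \<star> Y)"
      using Y W by (simp add: \<phi>_def swap.lam1_P2 swap.lam1_lie_xi fscale_assoc times_fun_def)
    then have "\<phi> (\<phi> (P1 (lie_bracket \<xi> Y))) = - ((\<lambda>_. b / 2) \<star> \<phi> Y)" using Y by simp
    then show ?thesis using W by (simp add: phi_phi)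
  qed
  have "\<phi> X = \<phi> (P1 X + P2 X + \<eta> X \<star> \<xi>)" using decompose[OF X] by simp
  also have "\<dots> = \<phi> (P1 X) + \<phi> (P2 X)" using X by simp
  finally have "\<phi> X = \<phi> (P1 X) + \<phi> (P2 X)" .
  then show ?thesis
    using X by (simp add: torsion_xi 1 2 h_def) (simp add: fun_eq_iff fscale_apply field_simps)
qed

text \<open>Both arguments are decomposed: pairs within one foliation contribute nothing, mixed
  pairs give \<open>2 d\<eta>\<close> times \<xi>, and pairs with \<xi> are covered by
  \<open>torsion_xi_phi\<close>.\<close>

lemma torsion_D:
  assumes X: "X \<in> V" and Y: "Y \<in> V"
  shows "torsion D X Y = ((\<lambda>_. 2) * d X Y) \<star> \<xi> + \<eta> Y \<star> ((\<lambda>_. (a + b) / 4) \<star> \<phi> X + \<phi> (h X))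
        - \<eta> X \<star> ((\<lambda>_. (a + b) / 4) \<star> \<phi> Y + \<phi> (h Y))"
proof -
  note T = tensor11_simps[OF torsion_tensor11[OF D_connection]]
  have dec: "torsion D X Y = torsion D (P1 X) Y + torsion D (P2 X) Y + \<eta> X \<star> torsion D \<xi> Y"
    if "X \<in> V" "Y \<in> V" for X Y
  proof -
    have "torsion D X Y = torsion D (P1 X + P2 X + \<eta> X \<star> \<xi>) Y"
      using decompose[OF that(1)] by simp
    also have "\<dots> = torsion D (P1 X) Y + torsion D (P2 X) Y + \<eta> X \<star> torsion D \<xi> Y"
      using that by (simp add: T)
    finally show ?thesis .
  qed
  have 1: "torsion D Z Y = ((\<lambda>_. 2) * d Z (P2 Y)) \<star> \<xi> + \<eta> Y \<star> torsion D Z \<xi>" if Z: "Z \<in> S1" for Z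
    using Z Y dec[OF Y S1_vf[OF Z]] torsion_swap[where Y=Z and X=Y]
      torsion_swap[where Y="P2 Y" and X=Z] torsion_swap[where Y=\<xi> and X=Z]
    by (simp add: torsion_S1 torsion_12)
  have 2: "torsion D Z Y = ((\<lambda>_. 2) * d Z (P1 Y)) \<star> \<xi> + \<eta> Y \<star> torsion D Z \<xi>" if Z: "Z \<in> S2" for Z
    using Z Y dec[OF Y S2_vf[OF Z]] torsion_swap[where Y=Z and X=Y]
      torsion_swap[where Y="P1 Y" and X=Z] torsion_swap[where Y=\<xi> and X=Z]
    by (simp add: swap.torsion_S1 swap.torsion_12)
  have "torsion D \<xi> \<xi> = 0"
    by (simp add: torsion_def lie_bracket_def fun_eq_iff)
  then have 3: "torsion D X \<xi> = torsion D (P1 X) \<xi> + torsion D (P2 X) \<xi>"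
    using dec[OF X xi_vf] by simp
  have "torsion D X Y = ((\<lambda>_. 2) * d X Y) \<star> \<xi> + \<eta> Y \<star> torsion D X \<xi> - \<eta> X \<star> torsion D Y \<xi>"
    using X Y unfolding dec[OF X Y] 1[OF P1_S1[OF X]] 2[OF P2_S2[OF X]] 3 d_decompose[OF X Y]
      torsion_swap[where Y=\<xi> and X=Y]
    by (simp add: fun_eq_iff fscale_apply algebra_simps)
  then show ?thesis
    by (simp only: torsion_xi_phi[OF X] torsion_xi_phi[OF Y])
qed

lemma D_phi:
  assumes X: "X \<in> V" and Y: "Y \<in> V"
  shows "D X (\<phi> Y) = \<phi> (D X Y)"
  using X Y by (simp add: \<phi>_def D_lam1 swap.D_lam1 vf_const[OF X])

lemma adapted: "adapted_connection A \<phi> h \<xi> \<eta> g D ((a + b) / 4) (((a - b) / 4)\<^sup>2)"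
proof unfold_locales
  show "h \<xi> = 0" by (simp add: h_def)
  fix X Y assume X: "X \<in> V" and Y: "Y \<in> V"
  show "g (h X) Y = g X (h Y)"
  proof -
    have "\<eta> (h Z) = 0" if "Z \<in> V" for Z using that by (simp add: h_def)
    moreover have "d (h X) (\<phi> Y) = d X (\<phi> (h Y))"
      using d_h[OF X, of "\<phi> Y"] X Y by (simp add: h_phi)
    ultimately show ?thesis using X Y by (simp add: g_def)
  qed
  show "D X (\<phi> Y) = \<phi> (D X Y)"
    using X Y by (rule D_phi)
  show "D X (h Y) = h (D X Y)"
    using X Y by (simp add: h_def D_P1 swap.D_P1 vf_const[OF X])
  \<comment> \<open>\<eta> is \<open>D\<close>-parallel, so \<open>g\<close> is too, being built
    from \<eta>, d\<eta> and \<phi>.\<close>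
  have eta: "Z (\<eta> X) = \<eta> (D Z X)" if X: "X \<in> V" and Z: "Z \<in> V" for X Z
  proof -
    have "D Z X = D Z (P1 X + P2 X + \<eta> X \<star> \<xi>)" using decompose[OF X] by simp
    also have "\<dots> = D Z (P1 X) + D Z (P2 X) + Z (\<eta> X) \<star> \<xi>"
      using X Z by simp
    finally show ?thesis using X Z vf_smooth[OF Z] by simp
  qed
  show "cov_deriv2 D g Z X Y = 0" if Z: "Z \<in> V" for Z
  proof -
    have "Z (d X (\<phi> Y)) = d (D Z X) (\<phi> Y) + d X (D Z (\<phi> Y))"
      using D_d[OF X phi_simps(1)[OF Y] Z] by (simp add: cov_deriv2_def algebra_simps)
    then show ?thesis
      unfolding cov_deriv2_def g_def using X Y Z
      by (simp add: vf_simps[OF Z] eta[OF X Z] eta[OF Y Z] D_phi algebra_simps)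
  qed
qed (simp_all add: contact_metric h_tensor11 h_phi h_h D_connection torsion_D)

text \<open>Stated for any \<open>T\<close> agreeing with \<open>h\<close> on vector fields, so that
  it applies to \<open>h_tensor \<phi> \<xi>\<close> for either order of the foliations.\<close>

lemma eigendistribution_h:
  assumes "a \<noteq> b" and T: "\<And>X. X \<in> V \<Longrightarrow> T X = h X"
  shows "eigendistribution A T ((a - b) / 4) = L1"
proof (intro ext set_eqI iffI)
  fix p u assume "u \<in> eigendistribution A T ((a - b) / 4) p"
  then obtain X where X: "X \<in> V" "u = value_at X p"
    and e: "value_at (T X) p = (\<lambda>f. (a - b) / 4 * value_at X p f)"
    unfolding eigendistribution_def by blast
  have dec: "value_at X p = value_at (P1 X) p + value_at (P2 X) p + (\<lambda>u. \<eta> X p * value_at \<xi> p u)"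
    by (subst decompose[OF X(1)]) (simp only: value_at_add value_at_fscale)
  \<comment> \<open>After division by \<open>(a - b) / 4\<close> the eigenvalue equation reads
    \<open>P1 X - P2 X = X\<close> at \<open>p\<close>; directness of the splitting then kills both
    remaining components.\<close>
  have "0 + (\<lambda>f. 2 * value_at (P2 X) p f) + (\<lambda>f. \<eta> X p * value_at \<xi> p f) = 0"
  proof
    fix f
    have "(a - b) / 4 * (value_at (P1 X) p f - value_at (P2 X) p f) = (a - b) / 4 * value_at X p f"
      using fun_cong[OF e, of f]
      by (simp only: T[OF X(1)] h_def value_at_fscale value_at_diff minus_apply)
    then have "value_at (P1 X) p f - value_at (P2 X) p f = value_at X p f"
      by (rule iffD1[OF mult_left_cancel, rotated]) (use \<open>a \<noteq> b\<close> in simp)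
    then show "(0 + (\<lambda>f. 2 * value_at (P2 X) p f) + (\<lambda>f. \<eta> X p * value_at \<xi> p f)) f = 0 f"
      unfolding dec by simp
  qed
  moreover have "(\<lambda>f. 2 * value_at (P2 X) p f) \<in> L2 p"
    by (rule subbundle_scale[OF L2 sections_value[OF P2_S2[OF X(1)]]])
  ultimately have "(\<lambda>f. 2 * value_at (P2 X) p f) = 0" "\<eta> X p = 0"
    using splitting subbundle_zero[OF L1, of p] unfolding bi_legendrian_def by blast+
  then have "value_at X p = value_at (P1 X) p"
    unfolding dec by (simp add: fun_eq_iff)
  then show "u \<in> L1 p"
    using X sections_value[OF P1_S1[OF X(1)], of p] by simp
next
  fix p u assume "u \<in> L1 p"
  then obtain X where X: "X \<in> S1" "value_at X p = u"
    by (rule sections_extend[OF L1])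
  then have "value_at (T X) p = (\<lambda>f. (a - b) / 4 * value_at X p f)"
    by (simp add: T h_def value_at_fscale)
  then show "u \<in> eigendistribution A T ((a - b) / 4) p"
    unfolding eigendistribution_def using X S1_vf[OF X(1)] by blast
qed

end

section \<open>The constants \<kappa>, \<mu> and the associated foliations\<close>

context parallel_bi_legendrian
begin

interpretation swap: parallel_bi_legendrian A n \<eta> \<xi> L2 L1 D \<Lambda>2 \<Lambda>1 b a
  by (rule swap)

interpretation adapted_connection A \<phi> h \<xi> \<eta> g D "(a + b) / 4" "((a - b) / 4)\<^sup>2"
  by (rule adapted)

lemma associated:
  assumes "a \<noteq> b"
  shows "associated_bi_legendrian (1 - (a - b)\<^sup>2 / 16) A \<phi> \<xi> L1 L2"
proof -
  define c where "c = (a - b) / 4"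
  have 1: "eigendistribution A (h_tensor \<phi> \<xi>) c = L1"
    unfolding c_def using assms h_tensor_eq by (rule eigendistribution_h)
  \<comment> \<open>Exchanging the foliations changes the sign of both factors in
    \<open>h\<close>.\<close>
  have "h_tensor \<phi> \<xi> X = swap.h X" if "X \<in> V" for X
    unfolding h_tensor_eq[OF that] h_def swap.h_def
    by (simp add: fun_eq_iff fscale_apply field_simps)
  then have "eigendistribution A (h_tensor \<phi> \<xi>) ((b - a) / 4) = L2"
    using assms by (intro swap.eigendistribution_h) auto
  moreover have "(b - a) / 4 = - c" by (simp add: c_def field_simps)
  ultimately have 2: "eigendistribution A (h_tensor \<phi> \<xi>) (- c) = L2" by simp
  have "1 - (1 - (a - b)\<^sup>2 / 16) = c\<^sup>2"
    by (simp add: c_def power_divide)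
  \<comment> \<open>The sign of \<open>c\<close> decides which foliation has the positive
    eigenvalue, which is why the pair is unordered.\<close>
  then have 3: "sqrt (1 - (1 - (a - b)\<^sup>2 / 16)) = \<bar>c\<bar>" by simp
  have
    "{eigendistribution A (h_tensor \<phi> \<xi>) \<bar>c\<bar>, eigendistribution A (h_tensor \<phi> \<xi>) (- \<bar>c\<bar>)} = {L1, L2}"
    by (cases "c \<ge> 0") (auto simp: 1 2)
  then show ?thesis
    unfolding associated_bi_legendrian_def 3 using assms by simp
qed

lemma
  shows kappa_mu_structure: "kappa_mu_manifold (1 - (a - b)\<^sup>2 / 16) (2 - (a + b) / 2) A \<phi> \<xi> \<eta> g"
    and sasakian_structure: "a = b \<Longrightarrow> sasakian A \<phi> \<xi> \<eta> g"
proof -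
  have 1: "1 - ((a - b) / 4)\<^sup>2 = 1 - (a - b)\<^sup>2 / 16" by (simp add: power_divide)
  have 2: "2 - 2 * ((a + b) / 4) = 2 - (a + b) / 2" by (simp add: field_simps)
  show "kappa_mu_manifold (1 - (a - b)\<^sup>2 / 16) (2 - (a + b) / 2) A \<phi> \<xi> \<eta> g"
    using kappa_mu unfolding 1 2 .
  assume ab: "a = b"
  \<comment> \<open>With \<open>a = b\<close> the term with \<open>h\<close> drops out for every
    value of \<mu>, and \<kappa> is 1.\<close>
  have h0: "h X = 0" for X
    unfolding h_def by (simp add: ab fun_eq_iff fscale_apply)
  have "curvature LC X Y \<xi> = \<eta> Y \<star> X - \<eta> X \<star> Y" if "X \<in> V" "Y \<in> V" for X Y
    unfolding curvature_LC_xi[OF that] h0 by (simp add: ab fun_eq_iff fscale_apply)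
  then show "sasakian A \<phi> \<xi> \<eta> g"
    unfolding sasakian_def using contact_metric levi_civita_LC by blast
qed

end

theorem theorem3p3:
  fixes n :: nat
    and A :: "('m::{t2_space, second_countable_topology}, 'e::euclidean_space) atlas"
    and \<eta> :: "'m vfield \<Rightarrow> 'm \<Rightarrow> real" and \<xi> :: "'m vfield"
    and F1 F2 :: "'m distribution"
    and D :: "'m vfield \<Rightarrow> 'm vfield \<Rightarrow> 'm vfield"
    and \<Lambda>1 \<Lambda>2 :: "'m vfield \<Rightarrow> 'm vfield"
    and a b :: real
  assumes "contact_manifold n A \<eta>" and "reeb_field A \<eta> \<xi>"
    and "bi_legendrian n A \<eta> \<xi> F1 F2"
    and "bi_legendrian_connection A \<eta> \<xi> F1 F2 D"
    and "pang_parallel A \<eta> \<xi> D F1" and "pang_parallel A \<eta> \<xi> D F2"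
    and "libermann_map A \<eta> \<xi> F1 \<Lambda>1" and "libermann_map A \<eta> \<xi> F2 \<Lambda>2"
    and "(pang_pos_def A \<eta> \<xi> F1 \<and> pang_pos_def A \<eta> \<xi> F2 \<and> a > 0 \<and> b > 0 \<and>
            pang_bar_proportional A \<eta> \<xi> F1 F2 \<Lambda>1 \<Lambda>2 (a * b)) \<or>
         (pang_pos_def A \<eta> \<xi> F1 \<and> pang_neg_def A \<eta> \<xi> F2 \<and> a > 0 \<and> b < 0 \<and>
            pang_bar_proportional A \<eta> \<xi> F1 F2 \<Lambda>1 \<Lambda>2 (a * b)) \<or>
         (pang_neg_def A \<eta> \<xi> F1 \<and> pang_neg_def A \<eta> \<xi> F2 \<and> a < 0 \<and> b < 0 \<and>
            pang_bar_proportional A \<eta> \<xi> F1 F2 \<Lambda>1 \<Lambda>2 (a * b))"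
  shows "\<exists>\<phi> g. contact_metric_structure A \<phi> \<xi> \<eta> g \<and>
           (a = b \<longrightarrow> sasakian A \<phi> \<xi> \<eta> g) \<and>
           (a \<noteq> b \<longrightarrow>
              kappa_mu_manifold (1 - (a - b)\<^sup>2 / 16) (2 - (a + b) / 2) A \<phi> \<xi> \<eta> g \<and>
              associated_bi_legendrian (1 - (a - b)\<^sup>2 / 16) A \<phi> \<xi> F1 F2)"
proof -
  interpret parallel_bi_legendrian A n \<eta> \<xi> F1 F2 D \<Lambda>1 \<Lambda>2 a b
  proof
    show "smooth_atlas A" and "one_form A \<eta>"
      using assms(1) by (simp_all add: contact_manifold_def)
    show "a \<noteq> 0" and "b \<noteq> 0" and "pang_bar_proportional A \<eta> \<xi> F1 F2 \<Lambda>1 \<Lambda>2 (a * b)"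
      using assms(9) by auto
    show "pang \<eta> \<xi> X X p / a > 0" if "X \<in> sections A F1" "value_at X p \<noteq> 0" for X p
      using assms(9) that
      by (auto simp: pang_pos_def_def pang_neg_def_def zero_less_divide_iff)
    show "pang \<eta> \<xi> X X p / b > 0" if "X \<in> sections A F2" "value_at X p \<noteq> 0" for X p
      using assms(9) that
      by (auto simp: pang_pos_def_def pang_neg_def_def zero_less_divide_iff)
  qed (rule assms)+
  show ?thesis
    using contact_metric kappa_mu_structure sasakian_structure associated by blast
qed

end
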